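(* Let $\gamma>0$ and consider the time-varying semidefinite program (TV-SDP) $$\sup_{x\in \mathbf{L}^n}\ \langle c,x\rangle_{\mathbf{L}^n}\quad\text{subject to}\quad Fx(t)\succeq 0\ \text{ for almost every } t\in[0,1],$$ with polynomial data, where $F$ explicitly imposes the bound $\|x(t)\|_\infty\le\gamma$, i.e. is of the block-diagonal form $$Fx=\begin{pmatrix}\hat Fx&0&0\\0&\gamma I-\mathrm{diag}(x)&0\\0&0&\mathrm{diag}(x)+\gamma I\end{pmatrix}.$$ Let $\mathrm{opt}\in\mathbb{R}\cup\{-\infty\}$ be the optimal value of this TV-SDP, and for $d\in\mathbb{N}$ let $$u_d=\sup\Big\{\langle c,x\rangle_{\mathbf{L}^n}\ :\ x\in\mathbf{L}^n,\ \int_0^1\mathrm{Tr}\big(Fx(t)P(t)\big)\,dt\ge0\ \text{ for all } P\in\mathbf{S}^+_d\Big\}.$$ Then $u_d\to\mathrm{opt}$ as $d\to\infty$.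
   Context: $\mathbf{L}^n$ is the set of measurable functions $x:[0,1]\to\mathbb{R}^n$ with $\sup_{t,i}|x_i(t)|<\infty$, and $\langle x,y\rangle_{\mathbf{L}^n}=\int_0^1\sum_{i=1}^n x_i(t)y_i(t)\,dt$. $c$ is a vector of $n$ univariate real polynomials. The map $\hat F$ (the remaining constraints) has the form $$\hat Fx(t)=A_0(t)+\sum_{i=1}^n x_i(t)A_i(t)+\sum_{i=1}^n\int_0^t x_i(s)D_i(t,s)\,ds,$$ where $A_0,\dots,A_n$ are symmetric $\hat m\times\hat m$ matrices with entries real polynomials in $t$ and $D_1,\dots,D_n$ are symmetric $\hat m\times\hat m$ matrices with entries real polynomials in $(t,s)$. Let $m=\hat m+2n$, the size of $Fx(t)$. $\mathrm{diag}(x)$ is the diagonal matrix with diagonal $x(t)$, and $I$ is the $n\times n$ identity. $\mathbf{S}^+_d$ is the set of symmetric $m\times m$ matrices $P$ whose entries are real polynomials in $t$ of degree at most $d$ and such that $P(t)$ is positive semidefinite for all $t\in[0,1]$. $M\succeq0$ means $M$ is positive semidefinite; "almost every" refers to Lebesgue measure. The supremum over an empty set is $-\infty$, and convergence is in the extended reals $[-\infty,+\infty]$. *)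

theory Defs
  imports "HOL-Analysis.Analysis" "HOL-Computational_Algebra.Polynomial"
begin

text \<open>
  The dimensions are index types: \<open>'n\<close> indexes the components of \<open>x(t)\<close> (so \<open>n = CARD('n)\<close>),
  \<open>'m\<close> indexes the rows and columns of the remaining constraints, and the full constraint matrix is
  indexed by the disjoint sum \<open>'m + ('n + 'n)\<close>, which has \<open>CARD('m) + 2 * CARD('n)\<close> elements.
\<close>

text \<open>
  A function on \<open>[0,1]\<close> is represented by a total function on the reals; everything below depends
  only on its values on \<open>[0,1]\<close>. Measurability is Lebesgue measurability.
\<close>

definition Ln :: "(real \<Rightarrow> real^'n) set" where
  "Ln = {x. x \<in> borel_measurable (lebesgue_on {0..1}) \<and>
            (\<exists>B. \<forall>t\<in>{0..1}. \<forall>i. \<bar>x t $ i\<bar> \<le> B)}"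

definition Ln_inner :: "(real \<Rightarrow> real^'n) \<Rightarrow> (real \<Rightarrow> real^'n) \<Rightarrow> real" where
  "Ln_inner x y = integral\<^sup>L (lebesgue_on {0..1}) (\<lambda>t. \<Sum>i\<in>UNIV. x t $ i * y t $ i)"

definition pos_semidef :: "real^'k^'k \<Rightarrow> bool" where
  "pos_semidef M \<longleftrightarrow> transpose M = M \<and> (\<forall>v. 0 \<le> v \<bullet> (M *v v))"

definition eval_vec :: "real poly^'n \<Rightarrow> real \<Rightarrow> real^'n" where
  "eval_vec p t = (\<chi> i. poly (p $ i) t)"

definition eval_mat :: "real poly^'k^'l \<Rightarrow> real \<Rightarrow> real^'k^'l" where
  "eval_mat P t = (\<chi> i j. poly (P $ i $ j) t)"

text \<open>
  A real polynomial in \<open>(t,s)\<close> is a polynomial in \<open>s\<close> whose coefficients are polynomials in \<open>t\<close>.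
\<close>

definition eval_mat2 :: "real poly poly^'k^'l \<Rightarrow> real \<Rightarrow> real \<Rightarrow> real^'k^'l" where
  "eval_mat2 P t s = (\<chi> i j. poly (poly (P $ i $ j) [:s:]) t)"

definition diag_mat :: "real^'n \<Rightarrow> real^'n^'n" where
  "diag_mat v = (\<chi> i j. if i = j then v $ i else 0)"

definition block_diag :: "real^'k^'k \<Rightarrow> real^'l^'l \<Rightarrow> real^('k + 'l)^('k + 'l)" where
  "block_diag M N = (\<chi> i j. case (i, j) of
      (Inl a, Inl b) \<Rightarrow> M $ a $ b
    | (Inr a, Inr b) \<Rightarrow> N $ a $ b
    | _ \<Rightarrow> 0)"

definition F_hat ::
  "real poly^'m^'m \<Rightarrow> ('n::finite \<Rightarrow> real poly^'m^'m) \<Rightarrow> ('n \<Rightarrow> real poly poly^'m^'m)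
    \<Rightarrow> (real \<Rightarrow> real^'n) \<Rightarrow> real \<Rightarrow> real^'m^'m" where
  "F_hat A0 A D x t =
     eval_mat A0 t + (\<Sum>i\<in>UNIV. x t $ i *\<^sub>R eval_mat (A i) t)
     + (\<Sum>i\<in>UNIV. integral\<^sup>L (lebesgue_on {0..t}) (\<lambda>s. x s $ i *\<^sub>R eval_mat2 (D i) t s))"

definition F_full ::
  "real \<Rightarrow> real poly^'m^'m \<Rightarrow> ('n::finite \<Rightarrow> real poly^'m^'m) \<Rightarrow> ('n \<Rightarrow> real poly poly^'m^'m)
    \<Rightarrow> (real \<Rightarrow> real^'n) \<Rightarrow> real \<Rightarrow> real^('m + ('n + 'n))^('m + ('n + 'n))" where
  "F_full \<gamma> A0 A D x t =
     block_diag (F_hat A0 A D x t)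
       (block_diag (\<gamma> *\<^sub>R mat 1 - diag_mat (x t)) (diag_mat (x t) + \<gamma> *\<^sub>R mat 1))"

definition S_plus :: "nat \<Rightarrow> (real poly^'k^'k) set" where
  "S_plus d = {P. transpose P = P \<and> (\<forall>i j. degree (P $ i $ j) \<le> d) \<and>
                  (\<forall>t\<in>{0..1}. pos_semidef (eval_mat P t))}"

definition tvsdp_feasible ::
  "real \<Rightarrow> real poly^'m^'m \<Rightarrow> ('n::finite \<Rightarrow> real poly^'m^'m) \<Rightarrow> ('n \<Rightarrow> real poly poly^'m^'m)
    \<Rightarrow> (real \<Rightarrow> real^'n) set" where
  "tvsdp_feasible \<gamma> A0 A D =
     {x \<in> Ln. AE t in lebesgue_on {0..1}. pos_semidef (F_full \<gamma> A0 A D x t)}"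

definition relaxed_feasible ::
  "real \<Rightarrow> real poly^'m^'m \<Rightarrow> ('n::finite \<Rightarrow> real poly^'m^'m) \<Rightarrow> ('n \<Rightarrow> real poly poly^'m^'m)
    \<Rightarrow> nat \<Rightarrow> (real \<Rightarrow> real^'n) set" where
  "relaxed_feasible \<gamma> A0 A D d =
     {x \<in> Ln. \<forall>P\<in>S_plus d.
        0 \<le> integral\<^sup>L (lebesgue_on {0..1}) (\<lambda>t. trace (F_full \<gamma> A0 A D x t ** eval_mat P t))}"

text \<open>The suprema are taken in the extended reals, where the empty supremum is \<open>-\<infinity>\<close>.\<close>

definition tvsdp_opt ::
  "real \<Rightarrow> real poly^'n \<Rightarrow> real poly^'m^'m \<Rightarrow> ('n::finite \<Rightarrow> real poly^'m^'m)
    \<Rightarrow> ('n \<Rightarrow> real poly poly^'m^'m) \<Rightarrow> ereal" where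
  "tvsdp_opt \<gamma> c A0 A D = (SUP x\<in>tvsdp_feasible \<gamma> A0 A D. ereal (Ln_inner (eval_vec c) x))"

definition relaxed_opt ::
  "real \<Rightarrow> real poly^'n \<Rightarrow> real poly^'m^'m \<Rightarrow> ('n::finite \<Rightarrow> real poly^'m^'m)
    \<Rightarrow> ('n \<Rightarrow> real poly poly^'m^'m) \<Rightarrow> nat \<Rightarrow> ereal" where
  "relaxed_opt \<gamma> c A0 A D d = (SUP x\<in>relaxed_feasible \<gamma> A0 A D d. ereal (Ln_inner (eval_vec c) x))"

end

theory Submission
  imports Defs
begin

text \<open>
  The optimal values \<open>u d\<close> of the relaxations decrease with \<open>d\<close>, since a larger \<open>d\<close> means more multipliers, so they
  converge to their infimum. They dominate the optimal value of the program because the trace of a product of two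
  positive semidefinite matrices is nonnegative (\<open>trace_mult_pos_semidef_nonneg\<close>). What has to be shown is that
  whenever \<open>r\<close> is strictly below all \<open>u d\<close>, there is a feasible \<open>z\<close> whose objective value is at least \<open>r\<close>
  (\<open>feasible_limit\<close>). It is obtained as a limit of functions \<open>x d\<close> that are feasible for the relaxation of order \<open>d\<close>
  and have objective value at least \<open>r\<close>.

  Three ideas make this limit work. Every constraint of the relaxation, like the objective, is affine in the
  polynomial moments of \<open>x\<close>: exchanging the order of integration turns the memory term into a pairing of \<open>x\<close> with
  a polynomial (\<open>volterra_integral\<close>, \<open>poly_affine_trace\<close>). So only polynomial moments must be controlled.

  The functions \<open>x d\<close> satisfy the bound \<open>\<gamma>\<close> only when tested against polynomials of degree at most \<open>d\<close>, and they
  may be unbounded as a sequence. Each of them is therefore replaced by a step function whose values are averages of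
  \<open>x d\<close> against normalised Bernstein polynomials. It is bounded by \<open>\<gamma>\<close> (\<open>abs_bernstein_step_le\<close>), and the Bernstein
  form of the Weierstrass theorem shows that its moments differ from those of \<open>x d\<close> by a quantity tending to 0
  (\<open>bernstein_step_moments\<close>). A bounded sequence has a limit that inherits all eventual linear inequalities
  (\<open>bounded_sequence_weak_limit\<close>); it is constructed by norm minimisation over decreasing convex sets.

  Finally, the limit satisfies the integrated constraint for polynomial multipliers of every degree. Testing with
  multipliers \<open>p * v v\<^sup>T\<close>, where \<open>p\<close> runs through the polynomials nonnegative on \<open>[0,1]\<close> and \<open>v\<close> through a countable
  dense set of vectors, gives positive semidefiniteness almost everywhere (\<open>AE_pos_semidef_of_S_plus\<close>).
\<close>

section \<open>Traces of products of positive semidefinite matrices\<close>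

definition outer :: "real^'k \<Rightarrow> real^'k^'k" where
  "outer v = (\<chi> i j. v $ i * v $ j)"

lemma quadratic_form_eq_sum:
  fixes M :: "real^'k^'k"
  shows "v \<bullet> (M *v w) = (\<Sum>i\<in>UNIV. \<Sum>j\<in>UNIV. v $ i * M $ i $ j * w $ j)"
  by (simp add: inner_vec_def matrix_vector_mult_def sum_distrib_left mult.assoc)

lemma trace_mult_eq_sum:
  fixes M N :: "real^'k^'k"
  shows "trace (M ** N) = (\<Sum>i\<in>UNIV. \<Sum>j\<in>UNIV. M $ i $ j * N $ j $ i)"
  by (simp add: trace_def matrix_matrix_mult_def)

lemma trace_mult_outer:
  fixes M :: "real^'k^'k"
  shows "trace (M ** outer v) = v \<bullet> (M *v v)"
  by (simp add: trace_mult_eq_sum quadratic_form_eq_sum outer_def mult_ac)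

lemma symmetric_iff: "transpose M = M \<longleftrightarrow> (\<forall>i j. M $ i $ j = M $ j $ i)"
  by (auto simp: transpose_def vec_eq_iff)

text \<open>
  The parabola along a coordinate axis. Its discriminant carries both facts about positive semidefinite
  matrices used below: a zero diagonal entry kills its row, and the Schur complement of a positive
  diagonal entry is again positive semidefinite.
\<close>

lemma quadratic_form_shift_axis:
  fixes N :: "real^'k^'k"
  assumes "transpose N = N"
  shows "(v + s *\<^sub>R axis i 1) \<bullet> (N *v (v + s *\<^sub>R axis i 1)) =
    v \<bullet> (N *v v) + 2 * s * (column i N \<bullet> v) + s\<^sup>2 * N $ i $ i"
proof -
  have sym: "axis i 1 \<bullet> (N *v v) = v \<bullet> (N *v axis i 1)"
    by (metis assms dot_lmul_matrix inner_commute transpose_matrix_vector)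
  have col: "N *v axis i 1 = column i N"
    by (simp add: matrix_vector_mul_component column_def vec_eq_iff matrix_vector_mult_def axis_def
        if_distrib cong: if_cong)
  have ii: "axis i 1 \<bullet> column i N = N $ i $ i"
    by (simp add: inner_axis' column_def)
  show ?thesis
    using sym by (simp add: matrix_vector_right_distrib scaleR_matrix_vector_assoc[symmetric]
        matrix_vector_mult_scaleR inner_add_left inner_add_right col ii inner_commute power2_eq_square algebra_simps)
qed

lemma quadratic_form_axis:
  fixes M :: "real^'k^'k"
  shows "axis i 1 \<bullet> (M *v axis i 1) = M $ i $ i"
  by (simp add: inner_axis' matrix_vector_mult_basis column_def)

lemma pos_semidef_diag_nonneg:
  assumes "pos_semidef N" shows "0 \<le> N $ i $ i"
  using assms quadratic_form_axis[of i N] by (metis pos_semidef_def)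

text \<open>
  With \<open>N $ i $ i = 0\<close> the parabola degenerates to an affine function of the shift,
  which is bounded below only if its slope \<open>2 * N $ j $ i\<close> vanishes.
\<close>

lemma pos_semidef_zero_diag_imp_zero_row:
  assumes N: "pos_semidef N" and z: "N $ i $ i = 0"
  shows "N $ i $ j = 0"
proof -
  have sym: "transpose N = N" using N by (simp add: pos_semidef_def)
  let ?v = "axis j 1 :: real^'a"
  define b where "b = column i N \<bullet> ?v"
  have b: "b = N $ j $ i"
    by (simp add: b_def inner_axis column_def)
  have ge: "0 \<le> ?v \<bullet> (N *v ?v) + 2 * s * b" for s
    using quadratic_form_shift_axis[OF sym, of ?v s i] N z
    by (metis add.right_neutral b_def mult_zero_right pos_semidef_def)
  have "b = 0"
  proof (rule ccontr)
    assume "b \<noteq> 0"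
    then show False
      using ge[of "- (?v \<bullet> (N *v ?v) + 1) / (2 * b)"] by (simp add: field_simps)
  qed
  then show ?thesis
    using b sym by (metis symmetric_iff)
qed

text \<open>
  One step of symmetric Gaussian elimination. The value of the new form at \<open>v\<close> is the minimum of the
  old form along the line through \<open>v\<close> in direction \<open>axis i 1\<close>, hence nonnegative.
\<close>

lemma pos_semidef_eliminate:
  assumes N: "pos_semidef N" and pos: "0 < N $ i $ i"
  shows "pos_semidef (N - (1 / N $ i $ i) *\<^sub>R outer (column i N))"
proof -
  have sym: "transpose N = N" using N by (simp add: pos_semidef_def)
  have "0 \<le> v \<bullet> ((N - (1 / N $ i $ i) *\<^sub>R outer (column i N)) *v v)" for v
  proof -
    define b where "b = column i N \<bullet> v"
    \<comment> \<open>The shift \<open>- b / N $ i $ i\<close> is the vertex of the parabola.\<close>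
    have "0 \<le> v \<bullet> (N *v v) + 2 * (- b / N $ i $ i) * b + (- b / N $ i $ i)\<^sup>2 * N $ i $ i"
      using quadratic_form_shift_axis[OF sym, of v "- b / N $ i $ i" i] N
      by (metis b_def pos_semidef_def)
    also have "\<dots> = v \<bullet> (N *v v) - b\<^sup>2 / N $ i $ i"
      using pos by (simp add: field_simps power2_eq_square)
    also have "b\<^sup>2 = v \<bullet> (outer (column i N) *v v)"
      unfolding quadratic_form_eq_sum
      by (simp add: b_def outer_def power2_eq_square inner_vec_def sum_product mult_ac)
    finally show ?thesis
      by (simp add: matrix_vector_mult_diff_rdistrib inner_diff_right
          scaleR_matrix_vector_assoc[symmetric])
  qed
  then show ?thesis
    using sym by (simp add: pos_semidef_def symmetric_iff outer_def)
qed

text \<open>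
  Weak duality for a single matrix pair. Elimination writes \<open>N\<close> as a sum of positive multiples of
  matrices \<open>outer u\<close>, and each of them contributes the value \<open>u \<bullet> (M *v u)\<close> to the trace. No
  eigenvalues are involved: every step clears one diagonal entry and does not revive cleared ones.
\<close>

lemma trace_mult_pos_semidef_nonneg:
  fixes M N :: "real^'k^'k"
  assumes M: "pos_semidef M" and N: "pos_semidef N"
  shows "0 \<le> trace (M ** N)"
  using N
proof (induction "card {i. N $ i $ i \<noteq> 0}" arbitrary: N rule: less_induct)
  case less
  show ?case
  proof (cases "\<forall>i. N $ i $ i = 0")
    case True
    then have "N $ i $ j = 0" for i j
      using pos_semidef_zero_diag_imp_zero_row[OF less.prems] by blast
    then show ?thesis
      by (simp add: trace_mult_eq_sum)
  next
    case False
    then obtain i where "N $ i $ i \<noteq> 0" by blast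
    then have pos: "0 < N $ i $ i"
      using pos_semidef_diag_nonneg[OF less.prems, of i] by simp
    define N' where "N' = N - (1 / N $ i $ i) *\<^sub>R outer (column i N)"
    have N': "pos_semidef N'"
      unfolding N'_def by (rule pos_semidef_eliminate[OF less.prems pos])
    have "N' $ j $ j = 0" if "N $ j $ j = 0" for j
      using pos_semidef_zero_diag_imp_zero_row[OF less.prems that, of i] that
      by (simp add: N'_def outer_def column_def)
    moreover have "N' $ i $ i = 0"
      using pos by (simp add: N'_def outer_def column_def)
    ultimately have "{j. N' $ j $ j \<noteq> 0} \<subset> {j. N $ j $ j \<noteq> 0}"
      using pos by force
    then have "card {j. N' $ j $ j \<noteq> 0} < card {j. N $ j $ j \<noteq> 0}"
      by (simp add: psubset_card_mono)
    then have "0 \<le> trace (M ** N')"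
      using less.hyps N' by blast
    moreover have "0 \<le> (1 / N $ i $ i) * trace (M ** outer (column i N))"
      using M pos by (simp add: trace_mult_outer pos_semidef_def)
    moreover have "trace (M ** N) =
        trace (M ** N') + (1 / N $ i $ i) * trace (M ** outer (column i N))"
      by (simp add: N'_def trace_mult_eq_sum sum_distrib_left sum.distrib[symmetric] algebra_simps)
    ultimately show ?thesis
      by linarith
  qed
qed

section \<open>Bounded measurable functions on the unit interval\<close>

abbreviation unit_leb :: "real measure" where
  "unit_leb \<equiv> lebesgue_on {0..1}"

lemma measure_unit_leb [simp]: "measure unit_leb {0..1} = 1"
  by (simp add: measure_restrict_space)

lemma finite_measure_unit_leb: "finite_measure unit_leb"
  by (simp add: finite_measure_lebesgue_on)

lemma integrable_unit_bounded:
  fixes f :: "real \<Rightarrow> 'b::euclidean_space"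
  assumes "f \<in> borel_measurable unit_leb" "\<And>t. t \<in> {0..1} \<Longrightarrow> norm (f t) \<le> B"
  shows "integrable unit_leb f"
  by (rule finite_measure.integrable_const_bound[OF finite_measure_unit_leb, where B = B])
     (use assms in \<open>auto intro!: AE_I2\<close>)

lemma borel_measurable_poly_unit [measurable]: "poly p \<in> borel_measurable unit_leb"
  for p :: "real poly"
  by (intro continuous_imp_measurable_on_sets_lebesgue continuous_intros) auto

lemma poly_bounded_unit:
  fixes p :: "real poly"
  obtains B where "\<And>t. t \<in> {0..1} \<Longrightarrow> \<bar>poly p t\<bar> \<le> B"
proof -
  have "bounded (poly p ` {0..1})"
    by (intro compact_imp_bounded compact_continuous_image continuous_intros) auto
  then obtain B where B: "\<forall>t\<in>{0..1}. \<bar>poly p t\<bar> \<le> B"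
    unfolding bounded_iff by auto
  show thesis
    by (rule that[of B]) (use B in blast)
qed

text \<open>
  The scalar functions that occur below are all bounded and measurable on \<open>[0,1]\<close>; this class is closed
  under sums and products, so that integrability of every integrand can be read off from its form.
\<close>

definition bounded_unit :: "(real \<Rightarrow> real) \<Rightarrow> bool" where
  "bounded_unit x \<longleftrightarrow> x \<in> borel_measurable unit_leb \<and> (\<exists>B. \<forall>t\<in>{0..1}. \<bar>x t\<bar> \<le> B)"

lemma bounded_unit_poly [simp, intro]: "bounded_unit (poly p)"
proof -
  obtain B where "\<And>t. t \<in> {0..1} \<Longrightarrow> \<bar>poly p t\<bar> \<le> B"
    using poly_bounded_unit[of p] by blast
  then show ?thesis
    unfolding bounded_unit_def by (blast intro: borel_measurable_poly_unit)
qed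

lemma bounded_unit_measurable: "bounded_unit x \<Longrightarrow> x \<in> borel_measurable unit_leb"
  by (simp add: bounded_unit_def)

lemma bounded_unit_mult [intro]:
  assumes "bounded_unit x" "bounded_unit y"
  shows "bounded_unit (\<lambda>t. x t * y t)"
proof -
  obtain A B where "\<forall>t\<in>{0..1}. \<bar>x t\<bar> \<le> A" "\<forall>t\<in>{0..1}. \<bar>y t\<bar> \<le> B"
    using assms by (auto simp: bounded_unit_def)
  then have "\<forall>t\<in>{0..1}. \<bar>x t * y t\<bar> \<le> \<bar>A\<bar> * B"
    by (auto simp: abs_mult intro!: mult_mono intro: order_trans[OF _ abs_ge_self])
  then show ?thesis
    using assms by (auto simp: bounded_unit_def)
qed

lemma bounded_unit_add [intro]:
  assumes "bounded_unit x" "bounded_unit y"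
  shows "bounded_unit (\<lambda>t. x t + y t)"
proof -
  obtain A B where "\<forall>t\<in>{0..1}. \<bar>x t\<bar> \<le> A" "\<forall>t\<in>{0..1}. \<bar>y t\<bar> \<le> B"
    using assms by (auto simp: bounded_unit_def)
  then have "\<forall>t\<in>{0..1}. \<bar>x t + y t\<bar> \<le> A + B"
    by (meson abs_triangle_ineq add_mono order_trans)
  then show ?thesis
    using assms by (auto simp: bounded_unit_def)
qed

lemma bounded_unit_const [simp, intro]: "bounded_unit (\<lambda>t. c)"
  by (auto simp: bounded_unit_def)

lemma bounded_unit_sum [intro]:
  assumes "\<And>i. i \<in> I \<Longrightarrow> bounded_unit (x i)"
  shows "bounded_unit (\<lambda>t. \<Sum>i\<in>I. x i t)"
  using assms by (induction I rule: infinite_finite_induct) auto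

lemma bounded_unit_integrable:
  assumes "bounded_unit x" shows "integrable unit_leb x"
  using assms integrable_unit_bounded by (force simp: bounded_unit_def)

lemma integral_unit_eq_henstock:
  assumes "bounded_unit x" shows "integral\<^sup>L unit_leb x = integral {0..1} x"
  by (rule lebesgue_integral_eq_integral) (use bounded_unit_integrable[OF assms] in auto)

lemma integral_unit_mono:
  assumes "bounded_unit x" "bounded_unit y" "\<And>t. t \<in> {0..1} \<Longrightarrow> x t \<le> y t"
  shows "integral\<^sup>L unit_leb x \<le> integral\<^sup>L unit_leb y"
  by (rule integral_mono) (use assms bounded_unit_integrable in auto)

section \<open>Bounded step functions with nearly the same moments\<close>

definition bernstein_poly :: "nat \<Rightarrow> nat \<Rightarrow> real poly" where
  "bernstein_poly n k = smult (of_nat (n choose k)) (monom 1 k * [:1, -1:] ^ (n - k))"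

lemma poly_bernstein_poly [simp]: "poly (bernstein_poly n k) t = Bernstein n k t"
  by (simp add: bernstein_poly_def Bernstein_def poly_monom)

lemma degree_bernstein_poly: "k \<le> n \<Longrightarrow> degree (bernstein_poly n k) \<le> n"
proof -
  assume k: "k \<le> n"
  have "degree (monom (1::real) k * [:1, -1:] ^ (n - k)) \<le> degree (monom (1::real) k) + degree ([:1::real, -1:] ^ (n - k))"
    by (rule degree_mult_le)
  also have "\<dots> \<le> k + (n - k)"
    using degree_power_le[of "[:1::real, -1:]" "n - k"] by (intro add_mono degree_monom_le) auto
  finally show ?thesis
    unfolding bernstein_poly_def using k degree_smult_le[of "of_nat (n choose k) :: real"] by (metis le_add_diff_inverse order_trans)
qed

lemma bounded_unit_Bernstein [simp, intro]: "bounded_unit (Bernstein n k)"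
proof -
  have "Bernstein n k = poly (bernstein_poly n k)" by auto
  then show ?thesis by (metis bounded_unit_poly)
qed

text \<open>
  An Euler beta integral; the value does not depend on \<open>k\<close>. This is what allows the surrogate below to live
  on equally long intervals.
\<close>

lemma integral_Bernstein:
  assumes k: "k \<le> n"
  shows "integral\<^sup>L unit_leb (Bernstein n k) = 1 / (real n + 1)"
proof -
  have "((\<lambda>t. t powr (real (Suc k) - 1) * (1 - t) powr (real (Suc (n - k)) - 1))
      has_integral Beta (real (Suc k)) (real (Suc (n - k)))) {0<..<1}"
    using has_integral_Beta_real[of "real (Suc k)" "real (Suc (n - k))"]
    by (simp add: has_integral_Icc_iff_Ioo)
  then have "((\<lambda>t. t ^ k * (1 - t) ^ (n - k))
      has_integral Beta (real (Suc k)) (real (Suc (n - k)))) {0<..<1}"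
    by (rule has_integral_eq[rotated]) (auto simp: powr_realpow)
  moreover have "Beta (real (Suc k)) (real (Suc (n - k))) = fact k * fact (n - k) / fact (Suc n)"
    using k Gamma_fact[of k, where 'a = real] Gamma_fact[of "n - k", where 'a = real]
      Gamma_fact[of "Suc n", where 'a = real]
    by (simp add: Beta_def of_nat_diff algebra_simps)
  ultimately have "((\<lambda>t. t ^ k * (1 - t) ^ (n - k))
      has_integral (fact k * fact (n - k) / fact (Suc n))) {0..1::real}"
    by (simp add: has_integral_Icc_iff_Ioo)
  then have "((\<lambda>t. real (n choose k) * (t ^ k * (1 - t) ^ (n - k)))
      has_integral (real (n choose k) * (fact k * fact (n - k) / fact (Suc n)))) {0..1::real}"
    by (rule has_integral_mult_right)
  moreover have "real (n choose k) * (fact k * fact (n - k) / fact (Suc n)) = 1 / (real n + 1)"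
  proof -
    have "fact k * fact (n - k) \<noteq> (0::real)" by simp
    then have "real (n choose k) * (fact k * fact (n - k)) = fact n"
      using k by (simp add: binomial_fact)
    then have "real (n choose k) * (fact k * fact (n - k) / fact (Suc n)) = fact n / fact (Suc n)"
      by simp
    also have "\<dots> = 1 / (real n + 1)"
      by (simp only: fact_Suc of_nat_mult of_nat_fact) (simp add: add.commute)
    finally show ?thesis .
  qed
  ultimately have "integral {0..1} (\<lambda>t. real (n choose k) * (t ^ k * (1 - t) ^ (n - k))) = 1 / (real n + 1)"
    by (metis integral_unique)
  then have "integral {0..1} (Bernstein n k) = 1 / (real n + 1)"
    by (simp only: Bernstein_def[abs_def] mult.assoc)
  then show ?thesis
    by (simp add: integral_unit_eq_henstock)
qed

text \<open>
  What testing the two constraints \<open>\<gamma> - x \<ge> 0\<close> and \<open>x + \<gamma> \<ge> 0\<close> against polynomials of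
  degree at most \<open>d\<close> reveals about \<open>x\<close>. It does not bound \<open>x\<close> itself, not even in an integral norm.
\<close>

definition moments_dominated :: "real \<Rightarrow> nat \<Rightarrow> (real \<Rightarrow> real) \<Rightarrow> bool" where
  "moments_dominated \<gamma> d x \<longleftrightarrow> (\<forall>p. degree p \<le> d \<longrightarrow> (\<forall>t\<in>{0..1}. 0 \<le> poly p t) \<longrightarrow>
     \<bar>integral\<^sup>L unit_leb (\<lambda>t. x t * poly p t)\<bar> \<le> \<gamma> * integral\<^sup>L unit_leb (poly p))"

text \<open>
  The domination hypothesis speaks of nonnegative polynomials only; writing \<open>r = (r + \<epsilon>) - \<epsilon>\<close> as a
  difference of two such polynomials extends it to polynomials of small absolute value.
\<close>

lemma moments_dominated_small:
  assumes x: "bounded_unit x" "moments_dominated \<gamma> d x" and \<gamma>: "0 \<le> \<gamma>"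
    and r: "degree r \<le> d" "\<And>t. t \<in> {0..1} \<Longrightarrow> \<bar>poly r t\<bar> \<le> \<epsilon>"
  shows "\<bar>integral\<^sup>L unit_leb (\<lambda>t. x t * poly r t)\<bar> \<le> 3 * \<gamma> * \<epsilon>"
proof -
  have \<epsilon>: "0 \<le> \<epsilon>" using r(2)[of 0] by simp
  let ?L = "\<lambda>p. integral\<^sup>L unit_leb (\<lambda>t. x t * poly p t)"
  have int: "integrable unit_leb (\<lambda>t. x t * poly p t)" for p
    using x by (intro bounded_unit_integrable bounded_unit_mult) auto
  have "\<bar>?L (r + [:\<epsilon>:])\<bar> \<le> \<gamma> * integral\<^sup>L unit_leb (poly (r + [:\<epsilon>:]))"
  proof -
    have "0 \<le> poly (r + [:\<epsilon>:]) t" if "t \<in> {0..1}" for t using r(2)[OF that] by simp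
    moreover have "degree (r + [:\<epsilon>:]) \<le> d" using r(1) by (intro degree_add_le) auto
    ultimately show ?thesis using x(2) by (auto simp: moments_dominated_def)
  qed
  also have "\<dots> \<le> \<gamma> * (2 * \<epsilon>)"
  proof (intro mult_left_mono \<gamma>)
    have "integral\<^sup>L unit_leb (poly (r + [:\<epsilon>:])) \<le> integral\<^sup>L unit_leb (\<lambda>t. 2 * \<epsilon>)"
      by (rule integral_unit_mono) (use r(2) in \<open>force+\<close>)
    then show "integral\<^sup>L unit_leb (poly (r + [:\<epsilon>:])) \<le> 2 * \<epsilon>" by simp
  qed
  finally have 1: "\<bar>?L (r + [:\<epsilon>:])\<bar> \<le> 2 * \<gamma> * \<epsilon>" by simp
  have "\<bar>?L [:\<epsilon>:]\<bar> \<le> \<gamma> * integral\<^sup>L unit_leb (poly [:\<epsilon>:])"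
    using x(2)[unfolded moments_dominated_def, rule_format, of "[:\<epsilon>:]"] \<epsilon> by simp
  moreover have "poly [:\<epsilon>:] = (\<lambda>t. \<epsilon>)" by auto
  ultimately have 2: "\<bar>?L [:\<epsilon>:]\<bar> \<le> \<gamma> * \<epsilon>" by simp
  have "?L (r + [:\<epsilon>:]) = ?L r + ?L [:\<epsilon>:]"
    using int[of r] int[of "[:\<epsilon>:]"] by (simp add: distrib_left)
  then show ?thesis
    using 1 2 by linarith
qed

text \<open>
  The bounded surrogate of \<open>x\<close>: on the \<open>k\<close>-th of \<open>n + 1\<close> equal intervals it takes the average value of
  \<open>x\<close> with respect to the probability density \<open>(n + 1) * Bernstein n k\<close>, which for large
  \<open>n\<close> is concentrated near that interval; at \<open>t = 1\<close>, outside all half-open intervals, it is 0. It depends on \<open>x\<close> only through moments of degree at most \<open>n\<close>.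
\<close>

definition bernstein_step :: "nat \<Rightarrow> (real \<Rightarrow> real) \<Rightarrow> real \<Rightarrow> real" where
  "bernstein_step n x t = (\<Sum>k\<le>n. (real n + 1) * integral\<^sup>L unit_leb (\<lambda>s. x s * Bernstein n k s) *
     indicator {real k / (real n + 1)..<(real k + 1) / (real n + 1)} t)"

lemma indicator_unit_measurable [measurable]: "(indicator {a..<b} :: real \<Rightarrow> real) \<in> borel_measurable unit_leb"
proof -
  have "{a..<b} \<in> sets lebesgue" by simp
  then show ?thesis
    by (metis borel_measurable_indicator measurable_restrict_space1)
qed

lemma bounded_unit_indicator [simp, intro]: "bounded_unit (indicator {a..<b})"
  by (auto simp: bounded_unit_def indicator_def intro!: exI[of _ 1])

lemma bernstein_step_measurable [measurable]: "bernstein_step n x \<in> borel_measurable unit_leb"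
  unfolding bernstein_step_def[abs_def] by measurable

lemma integral_unit_indicator:
  assumes "0 \<le> a" "a \<le> b" "b \<le> 1"
  shows "integral\<^sup>L unit_leb (indicator {a..<b}) = b - a"
proof -
  have "integral\<^sup>L unit_leb (indicator {a..<b}) = measure unit_leb ({a..<b} \<inter> space unit_leb)"
    by (rule Bochner_Integration.integral_indicator)
  also have "{a..<b} \<inter> space unit_leb = {a..<b}" using assms by auto
  also have "measure unit_leb {a..<b} = measure lebesgue {a..<b}"
    using assms by (intro measure_restrict_space) auto
  also have "\<dots> = b - a" using assms by simp
  finally show ?thesis .
qed

lemma bernstein_moment_bound:
  assumes "moments_dominated \<gamma> n x" "k \<le> n"
  shows "\<bar>(real n + 1) * integral\<^sup>L unit_leb (\<lambda>s. x s * Bernstein n k s)\<bar> \<le> \<gamma>"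
proof -
  have "\<bar>integral\<^sup>L unit_leb (\<lambda>s. x s * Bernstein n k s)\<bar> \<le> \<gamma> * (1 / (real n + 1))"
    using assms(1)[unfolded moments_dominated_def, rule_format, of "bernstein_poly n k"]
      degree_bernstein_poly[OF assms(2)] integral_Bernstein[OF assms(2)]
    by (simp add: Bernstein_nonneg cong: Bochner_Integration.integral_cong)
  then show ?thesis
    unfolding abs_mult by (simp add: field_simps)
qed

lemma sum_indicator_consecutive:
  fixes a :: "nat \<Rightarrow> real"
  assumes "incseq a"
  shows "(\<Sum>k\<le>n. indicator {a k..<a (Suc k)} t) = (indicator {a 0..<a (Suc n)} t :: real)"
proof (induction n)
  case (Suc n)
  have "a 0 \<le> a (Suc n)" "a (Suc n) \<le> a (Suc (Suc n))"
    using assms by (auto simp: incseq_def)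
  then show ?case using Suc by (auto simp: indicator_def)
qed simp

text \<open>
  Each value of the surrogate is \<open>n + 1\<close> times a moment against a Bernstein polynomial, and that moment is
  dominated by \<open>\<gamma>\<close> times the integral \<open>1 / (n + 1)\<close> of the polynomial.
\<close>

lemma abs_bernstein_step_le:
  assumes "moments_dominated \<gamma> n x" and \<gamma>: "0 \<le> \<gamma>"
  shows "\<bar>bernstein_step n x t\<bar> \<le> \<gamma>"
proof -
  let ?I = "\<lambda>k. indicator {real k / (real n + 1)..<(real k + 1) / (real n + 1)} t :: real"
  have "\<bar>bernstein_step n x t\<bar> \<le> (\<Sum>k\<le>n. \<bar>(real n + 1) * integral\<^sup>L unit_leb (\<lambda>s. x s * Bernstein n k s) * ?I k\<bar>)"
    unfolding bernstein_step_def by (rule sum_abs)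
  also have "\<dots> \<le> (\<Sum>k\<le>n. \<gamma> * ?I k)"
  proof (rule sum_mono)
    fix k assume "k \<in> {..n}"
    then have "\<bar>(real n + 1) * integral\<^sup>L unit_leb (\<lambda>s. x s * Bernstein n k s)\<bar> * ?I k \<le> \<gamma> * ?I k"
      using bernstein_moment_bound[OF assms(1)] by (intro mult_right_mono) auto
    then show "\<bar>(real n + 1) * integral\<^sup>L unit_leb (\<lambda>s. x s * Bernstein n k s) * ?I k\<bar> \<le> \<gamma> * ?I k"
      by (simp add: abs_mult)
  qed
  also have "\<dots> = \<gamma> * (\<Sum>k\<le>n. ?I k)"
    by (simp add: sum_distrib_left)
  also have "(\<Sum>k\<le>n. ?I k) = indicator {0..<1} t"
  proof -
    have "incseq (\<lambda>k. real k / (real n + 1))"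
      by (auto simp: incseq_def divide_right_mono)
    from sum_indicator_consecutive[OF this, of t n] show ?thesis
      by (simp add: add.commute)
  qed
  also have "\<gamma> * indicator {0..<1} t \<le> \<gamma>"
    using \<gamma> by (simp add: indicator_def)
  finally show ?thesis .
qed

text \<open>
  Let \<open>Q\<close> be the Bernstein approximation of \<open>q\<close> of order \<open>n\<close>. The moment of \<open>x\<close> against \<open>Q\<close> is a
  combination of the same Bernstein moments that define the surrogate, with weights \<open>q (k / n)\<close> in place of
  the means of \<open>q\<close> over the intervals; uniform continuity of \<open>q\<close> makes the difference small. Replacing
  \<open>Q\<close> by \<open>q\<close> is harmless since \<open>Q - q\<close> is a uniformly small polynomial of degree at most \<open>n\<close>.
  The threshold \<open>N\<close> is uniform in \<open>x\<close> because \<open>x\<close> will vary with \<open>n\<close>.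
\<close>

lemma bernstein_step_moments:
  fixes q :: "real poly"
  assumes \<gamma>: "0 \<le> \<gamma>" and \<epsilon>: "0 < \<epsilon>"
  obtains N where "\<And>n x. N \<le> n \<Longrightarrow> bounded_unit x \<Longrightarrow> moments_dominated \<gamma> n x \<Longrightarrow>
    \<bar>integral\<^sup>L unit_leb (\<lambda>t. bernstein_step n x t * poly q t) - integral\<^sup>L unit_leb (\<lambda>t. x t * poly q t)\<bar> \<le> \<epsilon>"
proof -
  \<comment> \<open>The oscillation of \<open>q\<close> costs \<open>\<gamma> * \<delta>\<close> and the passage from \<open>Q\<close> to \<open>q\<close> costs \<open>3 * \<gamma> * \<delta>\<close>;
    the summand 1 covers the case \<open>\<gamma> = 0\<close>.\<close>
  define \<delta> where "\<delta> = \<epsilon> / (4 * \<gamma> + 1)"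
  have \<delta>: "0 < \<delta>" "4 * \<gamma> * \<delta> \<le> \<epsilon>"
    using \<gamma> \<epsilon> by (auto simp: \<delta>_def field_simps)
  have cont: "continuous_on {0..1} (poly q)"
    by (intro continuous_intros)
  obtain N1 where N1: "\<And>n t. N1 \<le> n \<Longrightarrow> t \<in> {0..1} \<Longrightarrow>
      \<bar>poly q t - (\<Sum>k\<le>n. poly q (real k / real n) * Bernstein n k t)\<bar> < \<delta>"
    using Bernstein_Weierstrass[OF cont \<delta>(1)] by blast
  have "uniformly_continuous_on {0..1} (poly q)"
    using cont by (intro compact_uniformly_continuous) auto
  then obtain \<rho> where \<rho>: "0 < \<rho>" "\<And>s t. s \<in> {0..1} \<Longrightarrow> t \<in> {0..1} \<Longrightarrow> \<bar>s - t\<bar> < \<rho> \<Longrightarrow>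
      \<bar>poly q s - poly q t\<bar> < \<delta>"
    unfolding uniformly_continuous_on_def dist_real_def using \<delta>(1) by metis
  obtain N2 :: nat where N2: "1 / \<rho> < real N2"
    using reals_Archimedean2 by blast
  define N where "N = Suc (N1 + N2 + degree q)"
  show thesis
  proof (rule that)
    fix n x assume n: "N \<le> n" and x: "bounded_unit x" "moments_dominated \<gamma> n x"
    have n0: "0 < n" "N1 \<le> n" "degree q \<le> n" "1 / \<rho> < real n"
      using n N2 by (auto simp: N_def)
    define L where "L k = integral\<^sup>L unit_leb (\<lambda>s. x s * Bernstein n k s)" for k
    define I :: "nat \<Rightarrow> real \<Rightarrow> real" where
      "I k = indicator {real k / (real n + 1)..<(real k + 1) / (real n + 1)}" for k
    define Q where "Q = (\<Sum>k\<le>n. smult (poly q (real k / real n)) (bernstein_poly n k))"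
    have I_bdd[intro]: "bounded_unit (I k)" for k by (simp add: I_def)
    have I_int: "integral\<^sup>L unit_leb (I k) = 1 / (real n + 1)" if "k \<le> n" for k
      unfolding I_def using that by (subst integral_unit_indicator) (auto simp: field_simps)
    have polyQ: "poly Q t = (\<Sum>k\<le>n. poly q (real k / real n) * Bernstein n k t)" for t
      by (simp add: Q_def poly_sum)
    have degQ: "degree Q \<le> n"
      unfolding Q_def by (intro degree_sum_le) (auto simp: degree_bernstein_poly)
    have xB_int: "integrable unit_leb (\<lambda>t. x t * Bernstein n k t)" for k
      using x by (intro bounded_unit_integrable) auto
    have xQ: "integral\<^sup>L unit_leb (\<lambda>t. x t * poly Q t) = (\<Sum>k\<le>n. poly q (real k / real n) * L k)"
    proof -
      have "integral\<^sup>L unit_leb (\<lambda>t. x t * poly Q t) =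
          integral\<^sup>L unit_leb (\<lambda>t. \<Sum>k\<le>n. poly q (real k / real n) * (x t * Bernstein n k t))"
        by (simp add: polyQ sum_distrib_left mult_ac)
      also have "\<dots> = (\<Sum>k\<le>n. poly q (real k / real n) * L k)"
        using xB_int by (simp add: L_def)
      finally show ?thesis .
    qed
    have Iq_int: "integrable unit_leb (\<lambda>t. I k t * poly q t)" for k
      by (intro bounded_unit_integrable) auto
    have yq: "integral\<^sup>L unit_leb (\<lambda>t. bernstein_step n x t * poly q t) =
        (\<Sum>k\<le>n. (real n + 1) * L k * integral\<^sup>L unit_leb (\<lambda>t. I k t * poly q t))"
    proof -
      have "integral\<^sup>L unit_leb (\<lambda>t. bernstein_step n x t * poly q t) =
          integral\<^sup>L unit_leb (\<lambda>t. \<Sum>k\<le>n. (real n + 1) * L k * (I k t * poly q t))"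
        by (simp add: bernstein_step_def L_def I_def sum_distrib_right mult.assoc)
      also have "\<dots> = (\<Sum>k\<le>n. (real n + 1) * L k * integral\<^sup>L unit_leb (\<lambda>t. I k t * poly q t))"
        using Iq_int by simp
      finally show ?thesis .
    qed
    have local_error: "\<bar>(real n + 1) * L k * integral\<^sup>L unit_leb (\<lambda>t. I k t * poly q t) - poly q (real k / real n) * L k\<bar>
        \<le> \<gamma> * \<delta> / (real n + 1)" if k: "k \<le> n" for k
    proof -
      let ?c = "poly q (real k / real n)"
      have osc: "\<bar>I k t * (poly q t - ?c)\<bar> \<le> \<delta> * I k t" if t: "t \<in> {0..1}" for t
      proof (cases "I k t = 0")
        case False
        then have tk: "real k / (real n + 1) \<le> t" "t \<le> (real k + 1) / (real n + 1)"
          by (auto simp: I_def indicator_def split: if_splits)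
        \<comment> \<open>The sampling point \<open>k / n\<close> lies in the \<open>k\<close>-th interval, so that it is within \<open>1 / (n + 1)\<close> of \<open>t\<close>.\<close>
        have kn: "real k / (real n + 1) \<le> real k / real n" "real k / real n \<le> (real k + 1) / (real n + 1)"
          using k n0 by (auto simp: field_simps)
        have "(real k + 1) / (real n + 1) = real k / (real n + 1) + 1 / (real n + 1)"
          by (simp add: add_divide_distrib)
        then have "\<bar>t - real k / real n\<bar> \<le> 1 / (real n + 1)"
          using tk kn by linarith
        also have "\<dots> < \<rho>"
          using n0(1,4) \<rho>(1) by (simp add: field_simps) 
        finally have "\<bar>poly q t - ?c\<bar> < \<delta>"
          using t k n0 by (intro \<rho>(2)) auto
        then show ?thesis
          using False by (simp add: I_def indicator_def split: if_splits)
      qed simp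
      have d_bdd: "bounded_unit (\<lambda>t. I k t * (poly q t - ?c))"
        using bounded_unit_mult[OF I_bdd bounded_unit_poly[of "q - [:?c:]"]] by simp
      have "(real n + 1) * L k * integral\<^sup>L unit_leb (\<lambda>t. I k t * poly q t) - ?c * L k =
          (real n + 1) * L k * integral\<^sup>L unit_leb (\<lambda>t. I k t * (poly q t - ?c))"
        using Iq_int[of k] bounded_unit_integrable[OF I_bdd[of k]] I_int[OF k]
        by (simp add: right_diff_distrib)
      also have "\<bar>\<dots>\<bar> \<le> \<gamma> * (\<delta> * (1 / (real n + 1)))"
        unfolding abs_mult[of "(real n + 1) * L k"]
      proof (intro mult_mono \<gamma>)
        show "\<bar>(real n + 1) * L k\<bar> \<le> \<gamma>"
          unfolding L_def by (rule bernstein_moment_bound[OF x(2) k])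
        have "\<bar>integral\<^sup>L unit_leb (\<lambda>t. I k t * (poly q t - ?c))\<bar> \<le>
            integral\<^sup>L unit_leb (\<lambda>t. \<bar>I k t * (poly q t - ?c)\<bar>)"
          by (rule integral_abs_bound)
        also have "\<dots> \<le> integral\<^sup>L unit_leb (\<lambda>t. \<delta> * I k t)"
          using osc bounded_unit_integrable[OF d_bdd] bounded_unit_integrable[OF I_bdd]
          by (intro integral_mono) auto
        also have "\<dots> = \<delta> * (1 / (real n + 1))"
          by (simp add: I_int[OF k])
        finally show "\<bar>integral\<^sup>L unit_leb (\<lambda>t. I k t * (poly q t - ?c))\<bar> \<le> \<delta> * (1 / (real n + 1))" .
      qed auto
      finally show ?thesis by simp
    qed
    have "\<bar>integral\<^sup>L unit_leb (\<lambda>t. bernstein_step n x t * poly q t) - integral\<^sup>L unit_leb (\<lambda>t. x t * poly Q t)\<bar>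
        \<le> (\<Sum>k\<le>n. \<gamma> * \<delta> / (real n + 1))"
      unfolding yq xQ sum_subtractf[symmetric]
      by (rule order_trans[OF sum_abs sum_mono]) (use local_error in auto)
    also have "\<dots> = \<gamma> * \<delta>"
      by (simp add: field_simps)
    finally have 1: "\<bar>integral\<^sup>L unit_leb (\<lambda>t. bernstein_step n x t * poly q t) - integral\<^sup>L unit_leb (\<lambda>t. x t * poly Q t)\<bar>
        \<le> \<gamma> * \<delta>" .
    have "\<bar>integral\<^sup>L unit_leb (\<lambda>t. x t * poly (Q - q) t)\<bar> \<le> 3 * \<gamma> * \<delta>"
    proof (rule moments_dominated_small[OF x \<gamma>])
      show "degree (Q - q) \<le> n"
        using degQ n0 by (intro degree_diff_le)
      show "\<bar>poly (Q - q) t\<bar> \<le> \<delta>" if "t \<in> {0..1}" for t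
        using N1[OF n0(2) that] by (simp add: polyQ abs_minus_commute)
    qed
    moreover have "integral\<^sup>L unit_leb (\<lambda>t. x t * poly (Q - q) t) =
        integral\<^sup>L unit_leb (\<lambda>t. x t * poly Q t) - integral\<^sup>L unit_leb (\<lambda>t. x t * poly q t)"
      using bounded_unit_integrable[OF bounded_unit_mult[OF x(1) bounded_unit_poly]]
      by (simp add: right_diff_distrib)
    ultimately show "\<bar>integral\<^sup>L unit_leb (\<lambda>t. bernstein_step n x t * poly q t) - integral\<^sup>L unit_leb (\<lambda>t. x t * poly q t)\<bar> \<le> \<epsilon>"
      using 1 \<delta>(2) by linarith
  qed
qed

section \<open>Weak limits of bounded sequences\<close>

lemma integral_bounded_tendsto:
  fixes f :: "nat \<Rightarrow> 'a \<Rightarrow> real"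
  assumes fin: "finite_measure M"
    and "\<And>k. f k \<in> borel_measurable M" "g \<in> borel_measurable M"
    and "AE x in M. (\<lambda>k. f k x) \<longlonglongrightarrow> g x"
    and "\<And>k. AE x in M. \<bar>f k x\<bar> \<le> B"
  shows "(\<lambda>k. integral\<^sup>L M (f k)) \<longlonglongrightarrow> integral\<^sup>L M g"
  by (rule integral_dominated_convergence[where w = "\<lambda>_. B"])
     (use assms in \<open>auto intro: finite_measure.integrable_const\<close>)

text \<open>
  The core of the completeness of \<open>L\<^sup>1\<close>: by monotone convergence the pointwise sum of the increments
  has finite integral, so it is finite almost everywhere.
\<close>

lemma AE_convergent_of_summable_L1:
  fixes z :: "nat \<Rightarrow> 'a \<Rightarrow> 'b::euclidean_space"
  assumes meas: "\<And>k. z k \<in> borel_measurable M"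
    and int: "\<And>k. integrable M (\<lambda>x. norm (z (Suc k) x - z k x))"
    and summ: "summable (\<lambda>k. integral\<^sup>L M (\<lambda>x. norm (z (Suc k) x - z k x)))"
  shows "AE x in M. convergent (\<lambda>k. z k x)"
proof -
  let ?d = "\<lambda>k x. norm (z (Suc k) x - z k x)"
  note meas[measurable]
  have "(\<integral>\<^sup>+x. (\<Sum>k. ennreal (?d k x)) \<partial>M) = (\<Sum>k. \<integral>\<^sup>+x. ennreal (?d k x) \<partial>M)"
    by (rule nn_integral_suminf) measurable
  also have "\<dots> = (\<Sum>k. ennreal (integral\<^sup>L M (?d k)))"
    by (simp add: nn_integral_eq_integral int)
  also have "\<dots> = ennreal (\<Sum>k. integral\<^sup>L M (?d k))"
    by (rule suminf_ennreal2[OF _ summ]) simp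
  finally have "(\<integral>\<^sup>+x. (\<Sum>k. ennreal (?d k x)) \<partial>M) \<noteq> \<infinity>"
    by simp
  then have "AE x in M. (\<Sum>k. ennreal (?d k x)) \<noteq> \<infinity>"
    by (intro nn_integral_PInf_AE) measurable
  then show ?thesis
  proof eventually_elim
    case (elim x)
    then have "summable (\<lambda>k. ?d k x)"
      by (intro summable_suminf_not_top) auto
    then have "summable (\<lambda>k. z (Suc k) x - z k x)"
      by (rule summable_norm_cancel)
    then have "convergent (\<lambda>n. \<Sum>k<n. z (Suc k) x - z k x)"
      by (simp add: summable_iff_convergent)
    then have "convergent (\<lambda>n. z n x - z 0 x)"
      by (simp add: sum_lessThan_telescope[of "\<lambda>n. z n x"])
    then have "convergent (\<lambda>n. (z n x - z 0 x) + z 0 x)"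
      by (intro convergent_add convergent_const)
    then show ?case by simp
  qed
qed

text \<open>
  A sequential compactness principle: a bounded sequence has a point \<open>z\<close> with
  \<open>liminf \<integral> y e \<bullet> f \<le> \<integral> z \<bullet> f\<close> for all bounded \<open>f\<close> simultaneously. Instead of extracting a weakly
  convergent subsequence, consider the decreasing convex sets \<open>S N\<close> of all bounded functions that satisfy the
  linear inequalities valid for \<open>y e\<close> with \<open>e \<ge> N\<close>. Nearly norm-minimal elements of these sets form a
  Cauchy sequence in \<open>L\<^sup>2\<close> by the parallelogram identity, and an almost everywhere limit of them satisfies all
  those inequalities. The bound holds at every point so that \<open>z\<close> is again a bounded function in the strict sense.
\<close>

lemma bounded_sequence_weak_limit:
  fixes y :: "nat \<Rightarrow> 'a \<Rightarrow> 'b::euclidean_space"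
  assumes fin: "finite_measure M"
    and meas_y: "\<And>e. y e \<in> borel_measurable M"
    and bound_y: "\<And>e x. x \<in> space M \<Longrightarrow> norm (y e x) \<le> K"
    and K: "0 \<le> K"
  shows "\<exists>z. z \<in> borel_measurable M \<and> (\<forall>x. norm (z x) \<le> K) \<and>
    (\<forall>f C a N. f \<in> borel_measurable M \<longrightarrow> (\<forall>x\<in>space M. norm (f x) \<le> C) \<longrightarrow>
       (\<forall>e\<ge>N. a \<le> integral\<^sup>L M (\<lambda>x. y e x \<bullet> f x)) \<longrightarrow> a \<le> integral\<^sup>L M (\<lambda>x. z x \<bullet> f x))"
proof -
  interpret finite_measure M by (fact fin)
  have int_inner: "integrable M (\<lambda>x. w x \<bullet> f x)"
    if "w \<in> borel_measurable M" "\<And>x. x \<in> space M \<Longrightarrow> norm (w x) \<le> A"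
       "f \<in> borel_measurable M" "\<And>x. x \<in> space M \<Longrightarrow> norm (f x) \<le> C" for w f :: "'a \<Rightarrow> 'b" and A C
  proof (rule integrable_const_bound[where B = "\<bar>A\<bar> * C"])
    show "(\<lambda>x. w x \<bullet> f x) \<in> borel_measurable M"
      using that by measurable
    show "AE x in M. norm (w x \<bullet> f x) \<le> \<bar>A\<bar> * C"
    proof (rule AE_I2)
      fix x assume x: "x \<in> space M"
      have "norm (w x \<bullet> f x) \<le> norm (w x) * norm (f x)"
        using Cauchy_Schwarz_ineq2 by simp
      also have "\<dots> \<le> \<bar>A\<bar> * C"
        using that(2)[OF x] that(4)[OF x] by (intro mult_mono) auto
      finally show "norm (w x \<bullet> f x) \<le> \<bar>A\<bar> * C" .
    qed
  qed
  define test :: "('a \<Rightarrow> 'b) \<Rightarrow> bool" where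
    "test f \<longleftrightarrow> f \<in> borel_measurable M \<and> (\<exists>C. \<forall>x\<in>space M. norm (f x) \<le> C)" for f
  define S where "S N = {w. w \<in> borel_measurable M \<and> (\<forall>x\<in>space M. norm (w x) \<le> K) \<and>
     (\<forall>f a. test f \<longrightarrow> (\<forall>e\<ge>N. a \<le> integral\<^sup>L M (\<lambda>x. y e x \<bullet> f x)) \<longrightarrow> a \<le> integral\<^sup>L M (\<lambda>x. w x \<bullet> f x))}" for N
  have S_meas: "w \<in> borel_measurable M"
    and S_bound: "\<And>x. x \<in> space M \<Longrightarrow> norm (w x) \<le> K" if "w \<in> S N" for w N
    using that by (auto simp: S_def)
  have S_int: "integrable M (\<lambda>x. w x \<bullet> f x)" if "w \<in> S N" "test f" for w f N
  proof -
    obtain C where "f \<in> borel_measurable M" "\<And>x. x \<in> space M \<Longrightarrow> norm (f x) \<le> C"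
      using \<open>test f\<close> by (auto simp: test_def)
    then show ?thesis
      by (intro int_inner[OF S_meas[OF \<open>w \<in> S N\<close>] S_bound[OF \<open>w \<in> S N\<close>]])
  qed
  have S_test: "test w" if "w \<in> S N" for w N
    unfolding test_def using S_meas[OF that] S_bound[OF that] by blast
  have S_antimono: "S N' \<subseteq> S N" if "N \<le> N'" for N N'
  proof
    fix w assume w: "w \<in> S N'"
    have "a \<le> integral\<^sup>L M (\<lambda>x. w x \<bullet> f x)"
      if "test f" "\<forall>e\<ge>N. a \<le> integral\<^sup>L M (\<lambda>x. y e x \<bullet> f x)" for f a
      using w that \<open>N \<le> N'\<close> unfolding S_def by (simp only: mem_Collect_eq) (metis order_trans)
    then show "w \<in> S N"
      using S_meas[OF w] S_bound[OF w] by (simp add: S_def)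
  qed
  have y_S: "y N \<in> S N" for N
    by (auto simp: S_def meas_y bound_y)
  have S_mid: "(\<lambda>x. (1/2) *\<^sub>R (v x + w x)) \<in> S N" if v: "v \<in> S N" and w: "w \<in> S N" for v w N
  proof -
    have "norm ((1/2) *\<^sub>R (v x + w x)) \<le> K" if "x \<in> space M" for x
      using norm_triangle_ineq[of "v x" "w x"] S_bound[OF v that] S_bound[OF w that] by simp
    moreover have "a \<le> integral\<^sup>L M (\<lambda>x. ((1/2) *\<^sub>R (v x + w x)) \<bullet> f x)"
      if f: "test f" and a: "\<forall>e\<ge>N. a \<le> integral\<^sup>L M (\<lambda>x. y e x \<bullet> f x)" for f a
    proof -
      have "a \<le> integral\<^sup>L M (\<lambda>x. v x \<bullet> f x)" "a \<le> integral\<^sup>L M (\<lambda>x. w x \<bullet> f x)"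
        using v w f a unfolding S_def by blast+
      then have "a \<le> (integral\<^sup>L M (\<lambda>x. v x \<bullet> f x) + integral\<^sup>L M (\<lambda>x. w x \<bullet> f x)) / 2"
        by (simp add: field_simps)
      also have "\<dots> = integral\<^sup>L M (\<lambda>x. ((1/2) *\<^sub>R (v x + w x)) \<bullet> f x)"
        using S_int[OF v f] S_int[OF w f] by (simp add: inner_add_left)
      finally show ?thesis .
    qed
    ultimately show ?thesis
      using S_meas[OF v] S_meas[OF w] by (simp add: S_def)
  qed
  define J where "J w = integral\<^sup>L M (\<lambda>x. w x \<bullet> w x)" for w :: "'a \<Rightarrow> 'b"
  define m where "m N = Inf (J ` S N)" for N
  have J_nonneg: "0 \<le> J w" for w
    by (simp add: J_def)
  have bdd: "bdd_below (J ` S N)" for N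
    using J_nonneg by (auto intro!: bdd_belowI[of _ 0])
  have m_le: "m N \<le> J w" if "w \<in> S N" for w N
    unfolding m_def using that bdd by (auto intro: cInf_lower)
  have "incseq m"
    unfolding m_def using y_S bdd by (intro incseq_SucI cInf_superset_mono image_mono S_antimono) auto
  have J_le: "J (y N) \<le> K\<^sup>2 * measure M (space M)" for N
  proof -
    have "y N x \<bullet> y N x \<le> K\<^sup>2" if "x \<in> space M" for x
      using bound_y[OF that] power_mono[of "norm (y N x)" K 2] by (simp add: power2_norm_eq_inner)
    then have "J (y N) \<le> integral\<^sup>L M (\<lambda>_. K\<^sup>2)"
      unfolding J_def using S_int[OF y_S S_test[OF y_S]] by (intro integral_mono) auto
    then show ?thesis by (simp add: mult.commute)
  qed
  have m_bdd: "bdd_above (range m)"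
    using m_le[OF y_S] J_le by (intro bdd_aboveI2[where M = "K\<^sup>2 * measure M (space M)"]) (meson order_trans)
  define m' where "m' = (SUP N. m N)"
  have m_lim: "m \<longlonglongrightarrow> m'"
    unfolding m'_def by (rule LIMSEQ_incseq_SUP[OF m_bdd \<open>incseq m\<close>])
  have m_le': "m N \<le> m'" for N
    unfolding m'_def by (rule cSUP_upper[OF _ m_bdd]) simp
  have "\<exists>N w. k \<le> N \<and> w \<in> S N \<and> m' - (1/4)^k / 4 < m N \<and> J w < m N + (1/4)^k / 4" for k :: nat
  proof -
    have "eventually (\<lambda>N. m' - (1/4)^k / 4 < m N) sequentially"
      by (rule order_tendstoD(1)[OF m_lim]) simp
    then obtain N where N: "k \<le> N" "m' - (1/4)^k / 4 < m N"
      by (metis (mono_tags) eventually_sequentially linorder_le_cases order_refl)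
    have "\<exists>w\<in>J ` S N. w < m N + (1/4)^k / 4"
      unfolding m_def using y_S by (intro cInf_lessD) auto
    then show ?thesis using N by blast
  qed
  then obtain n z where nz: "\<And>k. k \<le> n k" "\<And>k. z k \<in> S (n k)" "\<And>k. m' - (1/4)^k / 4 < m (n k)"
      "\<And>k. J (z k) < m (n k) + (1/4)^k / 4"
    by metis
  \<comment> \<open>Parallelogram identity: both functions have squared norm at most \<open>m' + \<delta>\<close>, while their midpoint lies
    in \<open>S l\<close> and has squared norm at least \<open>m' - \<delta>\<close>.\<close>
  have z_diff: "integral\<^sup>L M (\<lambda>x. (z (Suc k) x - z k x) \<bullet> (z (Suc k) x - z k x)) \<le> 2 * (1/4)^k" for k
  proof -
    define l where "l = min (n k) (n (Suc k))"
    have in_S: "z k \<in> S l" "z (Suc k) \<in> S l"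
      using nz(2) S_antimono unfolding l_def by (meson min.cobounded1 min.cobounded2 subsetD)+
    have ints: "integrable M (\<lambda>x. z k x \<bullet> z k x)" "integrable M (\<lambda>x. z (Suc k) x \<bullet> z (Suc k) x)"
      "integrable M (\<lambda>x. z k x \<bullet> z (Suc k) x)"
      using S_int S_test in_S by blast+
    have l: "m' - (1/4)^k / 4 < m l"
    proof -
      have "(1/4)^Suc k / 4 \<le> (1/4::real)^k / 4" by simp
      then have "m' - (1/4)^k / 4 < m (n (Suc k))"
        using nz(3)[of "Suc k"] by linarith
      then show ?thesis
        using nz(3)[of k] by (simp add: l_def min_def)
    qed
    define \<delta> :: real where "\<delta> = (1/4)^k / 4"
    define mid where "mid = J (\<lambda>x. (1/2) *\<^sub>R (z (Suc k) x + z k x))"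
    have sq: "(1/4) * (J (z k) + J (z (Suc k)) + 2 * integral\<^sup>L M (\<lambda>x. z k x \<bullet> z (Suc k) x))
        = mid"
      unfolding mid_def J_def using ints
      by (simp add: inner_add_left inner_add_right inner_commute[of "z (Suc k) _" "z k _"] algebra_simps)
    have "integral\<^sup>L M (\<lambda>x. (z (Suc k) x - z k x) \<bullet> (z (Suc k) x - z k x)) =
        J (z k) + J (z (Suc k)) - 2 * integral\<^sup>L M (\<lambda>x. z k x \<bullet> z (Suc k) x)"
      unfolding J_def using ints
      by (simp add: inner_diff_left inner_diff_right inner_commute[of "z (Suc k) _" "z k _"] algebra_simps)
    also have "\<dots> = 2 * J (z k) + 2 * J (z (Suc k)) - 4 * mid"
      using sq by simp
    also have "\<dots> \<le> 2 * (m' + \<delta>) + 2 * (m' + \<delta>) - 4 * (m' - \<delta>)"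
    proof -
      have "(1/4)^Suc k / 4 \<le> \<delta>" by (simp add: \<delta>_def)
      then have "J (z k) \<le> m' + \<delta>" "J (z (Suc k)) \<le> m' + \<delta>"
        using nz(4)[of k, folded \<delta>_def] nz(4)[of "Suc k"] m_le'[of "n k"] m_le'[of "n (Suc k)"] by linarith+
      moreover have "m' - \<delta> \<le> mid"
        using l[folded \<delta>_def] m_le[OF S_mid[OF in_S(2,1)]] unfolding mid_def by linarith
      ultimately show ?thesis by argo
    qed
    finally show ?thesis by (simp add: \<delta>_def)
  qed
  have z_meas[measurable]: "z k \<in> borel_measurable M" for k
    using S_meas nz(2) by blast
  have z_bound: "norm (z k x) \<le> K" if "x \<in> space M" for k x
    using S_bound nz(2) that by blast
  have d_int: "integrable M (\<lambda>x. norm (z (Suc k) x - z k x))" for k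
    using z_bound norm_triangle_le_diff[OF add_mono[OF z_bound z_bound]]
    by (intro integrable_const_bound[where B = "K + K"] AE_I2) auto
  have d_le: "integral\<^sup>L M (\<lambda>x. norm (z (Suc k) x - z k x)) \<le> (1/2)^k * (2 + measure M (space M))" for k
  proof -
    have dd_int: "integrable M (\<lambda>x. (z (Suc k) x - z k x) \<bullet> (z (Suc k) x - z k x))"
      using norm_triangle_le_diff[OF add_mono[OF z_bound z_bound]]
      by (intro int_inner[where A = "K + K" and C = "K + K"]) auto
    have "integral\<^sup>L M (\<lambda>x. norm (z (Suc k) x - z k x)) \<le>
       integral\<^sup>L M (\<lambda>x. 2^k * ((z (Suc k) x - z k x) \<bullet> (z (Suc k) x - z k x)) + (1/2)^k)"
    proof (rule integral_mono)
      \<comment> \<open>From \<open>0 \<le> (2^k * a - 1)\<^sup>2\<close>: this trades the squared distances, of order \<open>4^-k\<close>, for distances of order \<open>2^-k\<close>.\<close>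
      show "norm (z (Suc k) x - z k x) \<le> 2^k * ((z (Suc k) x - z k x) \<bullet> (z (Suc k) x - z k x)) + (1/2)^k" for x
      proof -
        define a where "a = norm (z (Suc k) x - z k x)"
        have a: "0 \<le> a" by (simp add: a_def)
        have p: "(0::real) < 2^k" by simp
        have "0 \<le> (2^k * a - 1)\<^sup>2" by simp
        then have "2 * 2^k * a \<le> (2^k * a) * (2^k * a) + 1"
          by (simp add: power2_eq_square algebra_simps)
        moreover have "2^k * a \<le> 2 * 2^k * a" using a p by simp
        ultimately have "2^k * a \<le> 2^k * (2^k * (a * a) + (1/2)^k)"
          by (simp add: power_one_over algebra_simps)
        then have "a \<le> 2^k * (a * a) + (1/2)^k" using p by simp
        then show ?thesis
          by (simp add: a_def power2_norm_eq_inner[symmetric] power2_eq_square)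
      qed
    qed (use d_int dd_int in auto)
    also have "\<dots> = 2^k * integral\<^sup>L M (\<lambda>x. (z (Suc k) x - z k x) \<bullet> (z (Suc k) x - z k x))
        + (1/2)^k * measure M (space M)"
      using dd_int by simp
    also have "\<dots> \<le> 2^k * (2 * (1/4)^k) + (1/2)^k * measure M (space M)"
      using z_diff by (intro add_right_mono mult_left_mono) auto
    also have "(2::real)^k * (2 * (1/4)^k) = 2 * (1/2)^k"
      by (simp add: power_mult_distrib[symmetric])
    finally show ?thesis by (simp add: algebra_simps)
  qed
  have "summable (\<lambda>k. integral\<^sup>L M (\<lambda>x. norm (z (Suc k) x - z k x)))"
    by (rule summable_comparison_test[where g = "\<lambda>k. (1/2)^k * (2 + measure M (space M))"])
       (use d_le in \<open>auto intro!: summable_mult2 summable_geometric exI[of _ 0]\<close>)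
  then have conv: "AE x in M. convergent (\<lambda>k. z k x)"
    by (intro AE_convergent_of_summable_L1 d_int z_meas)
  \<comment> \<open>Where the sequence diverges, the value of \<open>lim\<close> is arbitrary and could violate the bound; 0 replaces it then.\<close>
  define u where "u x = (if norm (lim (\<lambda>k. z k x)) \<le> K then lim (\<lambda>k. z k x) else 0)" for x
  have u_meas[measurable]: "u \<in> borel_measurable M"
    unfolding u_def by measurable
  have u_lim: "AE x in M. (\<lambda>k. z k x) \<longlonglongrightarrow> u x"
    using conv AE_space
  proof eventually_elim
    case (elim x)
    then have lim: "(\<lambda>k. z k x) \<longlonglongrightarrow> lim (\<lambda>k. z k x)"
      by (simp add: convergent_LIMSEQ_iff)
    then have "norm (lim (\<lambda>k. z k x)) \<le> K"
      using z_bound elim by (intro LIMSEQ_le_const2[OF tendsto_norm]) auto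
    then show ?case using lim by (simp add: u_def)
  qed
  show ?thesis
  proof (intro exI[of _ u] conjI allI impI u_meas)
    show "norm (u x) \<le> K" for x
      using K by (simp add: u_def)
    show "a \<le> integral\<^sup>L M (\<lambda>x. u x \<bullet> f x)"
      if f[measurable]: "f \<in> borel_measurable M" and C: "\<forall>x\<in>space M. norm (f x) \<le> C"
        and a: "\<forall>e\<ge>N. a \<le> integral\<^sup>L M (\<lambda>x. y e x \<bullet> f x)" for f C a N
    proof -
      have "(\<lambda>k. integral\<^sup>L M (\<lambda>x. z k x \<bullet> f x)) \<longlonglongrightarrow> integral\<^sup>L M (\<lambda>x. u x \<bullet> f x)"
      proof (rule integral_bounded_tendsto[OF fin])
        show "AE x in M. (\<lambda>k. z k x \<bullet> f x) \<longlonglongrightarrow> u x \<bullet> f x"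
          using u_lim by eventually_elim (intro tendsto_intros)
        show "AE x in M. \<bar>z k x \<bullet> f x\<bar> \<le> K * C" for k
        proof (rule AE_I2)
          fix x assume x: "x \<in> space M"
          have "\<bar>z k x \<bullet> f x\<bar> \<le> norm (z k x) * norm (f x)"
            by (rule Cauchy_Schwarz_ineq2)
          also have "\<dots> \<le> K * C"
            using z_bound[OF x] bspec[OF C x] K by (intro mult_mono) auto
          finally show "\<bar>z k x \<bullet> f x\<bar> \<le> K * C" .
        qed
      qed measurable
      moreover have "a \<le> integral\<^sup>L M (\<lambda>x. z k x \<bullet> f x)" if "N \<le> k" for k
      proof -
        have "z k \<in> S N"
          using nz(1,2)[of k] that S_antimono by (meson order_trans subsetD)
        moreover have "test f"
          using f C by (auto simp: test_def)
        ultimately show ?thesis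
          using a unfolding S_def by blast
      qed
      ultimately show ?thesis
        by (intro LIMSEQ_le_const) auto
    qed
  qed
qed

section \<open>Constraints as affine functions of polynomial moments\<close>

lemma unit_id_measurable [measurable]: "(\<lambda>t. t) \<in> borel_measurable unit_leb"
  by (intro continuous_imp_measurable_on_sets_lebesgue continuous_intros) auto

lemma lebesgue_on_initial: "t \<in> {0..1} \<Longrightarrow> lebesgue_on {0..t} = restrict_space unit_leb {0..t}"
  by (simp add: restrict_restrict_space Int_absorb1)

lemma integral_initial:
  fixes h :: "real \<Rightarrow> 'b::euclidean_space"
  assumes "t \<in> {0..1}"
  shows "integral\<^sup>L (lebesgue_on {0..t}) h = integral\<^sup>L unit_leb (\<lambda>s. indicator {0..t} s *\<^sub>R h s)"
  unfolding lebesgue_on_initial[OF assms]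
  by (rule integral_restrict_space) (use assms in \<open>auto simp: sets_restrict_space\<close>)

lemma poly_antiderivative:
  fixes r :: "real poly"
  obtains R where "pderiv R = r"
proof
  show "pderiv (\<Sum>i\<le>degree r. monom (coeff r i / real (Suc i)) (Suc i)) = r"
    by (rule poly_eqI) (auto simp: coeff_pderiv coeff_sum not_le coeff_eq_0 simp del: of_nat_Suc)
qed

lemma integral_poly_tail:
  assumes s: "s \<in> {0..1}"
  shows "integral\<^sup>L unit_leb (\<lambda>t. if s \<le> t then poly (pderiv R) t else 0) = poly R 1 - poly R s"
proof -
  have "integral\<^sup>L unit_leb (\<lambda>t. if s \<le> t then poly (pderiv R) t else 0) =
      integral\<^sup>L unit_leb (\<lambda>t. indicator {s..1} t *\<^sub>R poly (pderiv R) t)"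
    by (rule Bochner_Integration.integral_cong) (auto simp: indicator_def)
  also have "\<dots> = integral\<^sup>L (restrict_space unit_leb {s..1}) (poly (pderiv R))"
    by (rule integral_restrict_space[symmetric]) (use s in \<open>auto simp: sets_restrict_space\<close>)
  also have "restrict_space unit_leb {s..1} = lebesgue_on {s..1}"
    using s by (simp add: restrict_restrict_space Int_absorb1)
  also have "integral\<^sup>L (lebesgue_on {s..1}) (poly (pderiv R)) = integral {s..1} (poly (pderiv R))"
    by (intro lebesgue_integral_eq_integral continuous_imp_integrable_real continuous_intros) auto
  also have "\<dots> = poly R 1 - poly R s"
  proof (rule integral_unique, rule fundamental_theorem_of_calculus)
    show "(poly R has_vector_derivative poly (pderiv R) t) (at t within {s..1})" for t
      by (metis DERIV_subset has_real_derivative_iff_has_vector_derivative poly_DERIV subset_UNIV)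
  qed (use s in auto)
  finally show ?thesis .
qed

text \<open>
  Exchanging the order of integration over the triangle \<open>s \<le> t\<close> turns the memory term into the pairing of
  \<open>h\<close> with a polynomial: the inner integral over \<open>t\<close> from \<open>s\<close> to 1 is a difference of values of the
  antiderivative \<open>R\<close>.
\<close>

lemma volterra_integral:
  assumes h: "bounded_unit h"
  shows "bounded_unit (\<lambda>t. integral\<^sup>L (lebesgue_on {0..t}) h)"
    and "integral\<^sup>L unit_leb (\<lambda>t. integral\<^sup>L (lebesgue_on {0..t}) h * poly (pderiv R) t) =
      integral\<^sup>L unit_leb (\<lambda>s. h s * (poly R 1 - poly R s))"
proof -
  interpret finite_measure unit_leb by (rule finite_measure_unit_leb)
  interpret P: pair_sigma_finite unit_leb unit_leb ..
  obtain C where C: "\<And>t. t \<in> {0..1} \<Longrightarrow> \<bar>h t\<bar> \<le> C"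
    using h unfolding bounded_unit_def by blast
  have C0: "0 \<le> C" using C[of 0] by simp
  have h_meas[measurable]: "h \<in> borel_measurable unit_leb"
    using h by (simp add: bounded_unit_def)
  have [measurable]: "(\<lambda>z. fst z) \<in> borel_measurable (unit_leb \<Otimes>\<^sub>M unit_leb)"
    "(\<lambda>z. snd z) \<in> borel_measurable (unit_leb \<Otimes>\<^sub>M unit_leb)"
    by (rule measurable_compose[OF measurable_fst unit_id_measurable]
             measurable_compose[OF measurable_snd unit_id_measurable])+
  have initial: "integral\<^sup>L (lebesgue_on {0..t}) h = integral\<^sup>L unit_leb (\<lambda>s. if s \<le> t then h s else 0)"
    if "t \<in> {0..1}" for t
    unfolding integral_initial[OF that]
    by (rule Bochner_Integration.integral_cong) (auto simp: indicator_def)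
  have "(\<lambda>t. integral\<^sup>L unit_leb (\<lambda>s. if s \<le> t then h s else 0)) \<in> borel_measurable unit_leb"
    by (rule borel_measurable_lebesgue_integral) measurable
  then have "(\<lambda>t. integral\<^sup>L (lebesgue_on {0..t}) h) \<in> borel_measurable unit_leb"
    by (rule measurable_cong[THEN iffD1, rotated]) (simp add: initial)
  moreover have "\<bar>integral\<^sup>L (lebesgue_on {0..t}) h\<bar> \<le> C" if "t \<in> {0..1}" for t
  proof -
    have "\<bar>integral\<^sup>L unit_leb (\<lambda>s. if s \<le> t then h s else 0)\<bar> \<le> integral\<^sup>L unit_leb (\<lambda>s. \<bar>if s \<le> t then h s else 0\<bar>)"
      by (rule integral_abs_bound)
    also have "\<dots> \<le> integral\<^sup>L unit_leb (\<lambda>s. C)"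
      using C C0 by (intro integral_mono integrable_unit_bounded[where B = C]) (auto simp del: unit_id_measurable)
    finally show ?thesis using initial[OF that] by simp
  qed
  ultimately show "bounded_unit (\<lambda>t. integral\<^sup>L (lebesgue_on {0..t}) h)"
    unfolding bounded_unit_def by blast
  obtain B where B: "\<And>t. t \<in> {0..1} \<Longrightarrow> \<bar>poly (pderiv R) t\<bar> \<le> B"
    using poly_bounded_unit[of "pderiv R"] by blast
  define f where "f s t = (if s \<le> t then h s * poly (pderiv R) t else 0)" for s t
  have "(\<lambda>z. poly (pderiv R) (snd z)) \<in> borel_measurable (unit_leb \<Otimes>\<^sub>M unit_leb)"
       "(\<lambda>z. h (fst z)) \<in> borel_measurable (unit_leb \<Otimes>\<^sub>M unit_leb)"
    by measurable
  then have f_meas: "case_prod f \<in> borel_measurable (unit_leb \<Otimes>\<^sub>M unit_leb)"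
    unfolding f_def[abs_def] case_prod_beta' by measurable
  have f_int: "integrable (unit_leb \<Otimes>\<^sub>M unit_leb) (case_prod f)"
  proof (rule finite_measure.integrable_const_bound[OF _ _ f_meas, where B = "C * B"])
    show "finite_measure (unit_leb \<Otimes>\<^sub>M unit_leb)"
      by (intro finite_measure_pair_measure finite_measure_unit_leb)
    show "AE z in unit_leb \<Otimes>\<^sub>M unit_leb. norm (case_prod f z) \<le> C * B"
    proof (rule AE_I2)
      fix z assume "z \<in> space (unit_leb \<Otimes>\<^sub>M unit_leb)"
      then have z: "fst z \<in> {0..1}" "snd z \<in> {0..1}" by (auto simp: space_pair_measure)
      have "\<bar>h (fst z)\<bar> * \<bar>poly (pderiv R) (snd z)\<bar> \<le> C * B"
        by (intro mult_mono C B z C0) auto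
      then show "norm (case_prod f z) \<le> C * B"
        using C0 B[OF z(2)] by (auto simp: f_def case_prod_beta' abs_mult intro: order_trans[OF _ mult_nonneg_nonneg])
    qed
  qed
  have "integral\<^sup>L unit_leb (\<lambda>t. integral\<^sup>L (lebesgue_on {0..t}) h * poly (pderiv R) t) =
      integral\<^sup>L unit_leb (\<lambda>t. integral\<^sup>L unit_leb (\<lambda>s. f s t))"
  proof (rule Bochner_Integration.integral_cong[OF refl])
    fix t assume "t \<in> space unit_leb"
    then have t: "t \<in> {0..1}" by simp
    have "integral\<^sup>L (lebesgue_on {0..t}) h * poly (pderiv R) t =
        integral\<^sup>L unit_leb (\<lambda>s. (if s \<le> t then h s else 0) * poly (pderiv R) t)"
      unfolding initial[OF t] by simp
    then show "integral\<^sup>L (lebesgue_on {0..t}) h * poly (pderiv R) t = integral\<^sup>L unit_leb (\<lambda>s. f s t)"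
      by (simp add: f_def if_distrib[of "\<lambda>y. y * poly (pderiv R) t"] cong: if_cong)
  qed
  also have "\<dots> = integral\<^sup>L unit_leb (\<lambda>s. integral\<^sup>L unit_leb (\<lambda>t. f s t))"
    by (rule P.Fubini_integral[OF f_int])
  also have "\<dots> = integral\<^sup>L unit_leb (\<lambda>s. h s * (poly R 1 - poly R s))"
  proof (rule Bochner_Integration.integral_cong[OF refl])
    fix s assume "s \<in> space unit_leb"
    then have s: "s \<in> {0..1}" by simp
    have "integral\<^sup>L unit_leb (\<lambda>t. f s t) =
        integral\<^sup>L unit_leb (\<lambda>t. h s * (if s \<le> t then poly (pderiv R) t else 0))"
      by (simp add: f_def if_distrib[of "\<lambda>y. h s * y"] cong: if_cong)
    then show "integral\<^sup>L unit_leb (\<lambda>t. f s t) = h s * (poly R 1 - poly R s)"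
      by (simp add: integral_poly_tail[OF s])
  qed
  finally show "integral\<^sup>L unit_leb (\<lambda>t. integral\<^sup>L (lebesgue_on {0..t}) h * poly (pderiv R) t) =
      integral\<^sup>L unit_leb (\<lambda>s. h s * (poly R 1 - poly R s))" .
qed

lemma bounded_unit_component [intro]:
  assumes "x \<in> Ln" shows "bounded_unit (\<lambda>t. x t $ i)"
proof -
  have [measurable]: "x \<in> borel_measurable unit_leb" using assms by (simp add: Ln_def)
  have "(\<lambda>t. x t $ i) \<in> borel_measurable unit_leb" 
    by (rule measurable_compose[OF _ borel_measurable_continuous_onI]) (auto intro!: continuous_intros)
  then show ?thesis using assms by (auto simp: Ln_def bounded_unit_def)
qed

lemma Ln_inner_eval_vec:
  assumes "x \<in> Ln"
  shows "Ln_inner x (eval_vec g) = (\<Sum>i\<in>UNIV. integral\<^sup>L unit_leb (\<lambda>t. x t $ i * poly (g $ i) t))"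
  unfolding Ln_inner_def eval_vec_def using assms
  by (simp add: bounded_unit_integrable[OF bounded_unit_mult[OF bounded_unit_component bounded_unit_poly]])

text \<open>
  The functional obtained by integrating \<open>\<Phi> x\<close> is affine in \<open>x\<close> and sees \<open>x\<close> only through finitely many
  polynomial moments. Such functionals pass to limits in which merely the polynomial moments are controlled.
\<close>

definition poly_affine :: "((real \<Rightarrow> real^'n) \<Rightarrow> real \<Rightarrow> real) \<Rightarrow> bool" where
  "poly_affine \<Phi> \<longleftrightarrow> (\<exists>a g. \<forall>x\<in>Ln. bounded_unit (\<Phi> x) \<and>
     integral\<^sup>L unit_leb (\<Phi> x) = a + Ln_inner x (eval_vec g))"

lemma poly_affine_cong:
  assumes "poly_affine \<Psi>" "\<And>x t. x \<in> Ln \<Longrightarrow> t \<in> {0..1} \<Longrightarrow> \<Phi> x t = \<Psi> x t"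
  shows "poly_affine \<Phi>"
proof -
  have "bounded_unit (\<Phi> x) = bounded_unit (\<Psi> x)" if "x \<in> Ln" for x
  proof -
    have "\<Phi> x \<in> borel_measurable unit_leb \<longleftrightarrow> \<Psi> x \<in> borel_measurable unit_leb"
      by (rule measurable_cong) (simp add: assms(2) that)
    then show ?thesis using assms(2)[OF that] by (simp add: bounded_unit_def)
  qed
  moreover have "integral\<^sup>L unit_leb (\<Phi> x) = integral\<^sup>L unit_leb (\<Psi> x)" if "x \<in> Ln" for x
    by (rule Bochner_Integration.integral_cong) (simp_all add: assms(2) that)
  ultimately show ?thesis
    using assms(1) by (simp add: poly_affine_def)
qed

lemma poly_affine_poly: "poly_affine (\<lambda>x. poly p)"
  unfolding poly_affine_def
  by (intro exI[of _ "integral\<^sup>L unit_leb (poly p)"] exI[of _ 0]) (simp add: Ln_inner_eval_vec)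

lemma poly_affine_zero: "poly_affine (\<lambda>x t. 0)"
  by (rule poly_affine_cong[OF poly_affine_poly[of 0]]) simp

lemma poly_affine_add:
  assumes "poly_affine \<Phi>" "poly_affine \<Psi>"
  shows "poly_affine (\<lambda>x t. \<Phi> x t + \<Psi> x t)"
proof -
  obtain a g where \<Phi>: "\<And>x. x \<in> Ln \<Longrightarrow> bounded_unit (\<Phi> x)"
      "\<And>x. x \<in> Ln \<Longrightarrow> integral\<^sup>L unit_leb (\<Phi> x) = a + Ln_inner x (eval_vec g)"
    using assms(1) by (auto simp: poly_affine_def)
  obtain b k where \<Psi>: "\<And>x. x \<in> Ln \<Longrightarrow> bounded_unit (\<Psi> x)"
      "\<And>x. x \<in> Ln \<Longrightarrow> integral\<^sup>L unit_leb (\<Psi> x) = b + Ln_inner x (eval_vec k)"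
    using assms(2) by (auto simp: poly_affine_def)
  have "Ln_inner x (eval_vec (g + k)) = Ln_inner x (eval_vec g) + Ln_inner x (eval_vec k)"
    if "x \<in> Ln" for x
    using that bounded_unit_integrable[OF bounded_unit_mult[OF bounded_unit_component[OF that] bounded_unit_poly]]
    by (simp add: Ln_inner_eval_vec distrib_left sum.distrib)
  then have "integral\<^sup>L unit_leb (\<lambda>t. \<Phi> x t + \<Psi> x t) = (a + b) + Ln_inner x (eval_vec (g + k))"
    if "x \<in> Ln" for x
    using that \<Phi> \<Psi> by (simp add: bounded_unit_integrable)
  then show ?thesis
    unfolding poly_affine_def using \<Phi>(1) \<Psi>(1) by blast
qed

lemma poly_affine_sum:
  assumes "\<And>i. i \<in> I \<Longrightarrow> poly_affine (\<Phi> i)"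
  shows "poly_affine (\<lambda>x t. \<Sum>i\<in>I. \<Phi> i x t)"
  using assms by (induction I rule: infinite_finite_induct) (auto intro: poly_affine_add poly_affine_zero)

lemma poly_affine_component: "poly_affine (\<lambda>x t. x t $ i * poly p t)"
proof -
  have "integral\<^sup>L unit_leb (\<lambda>t. x t $ i * poly p t) = 0 + Ln_inner x (eval_vec (\<chi> j. if j = i then p else 0))"
    if "x \<in> Ln" for x
  proof -
    have "integral\<^sup>L unit_leb (\<lambda>t. x t $ j * poly (if j = i then p else 0) t) =
      (if j = i then integral\<^sup>L unit_leb (\<lambda>t. x t $ i * poly p t) else 0)" for j
      by simp
    then show ?thesis using that by (simp add: Ln_inner_eval_vec)
  qed
  then show ?thesis
    unfolding poly_affine_def
    by (intro exI[of _ 0] exI[of _ "\<chi> j. if j = i then p else 0"]) auto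
qed

lemma poly_affine_volterra_monomial:
  "poly_affine (\<lambda>x t. integral\<^sup>L (lebesgue_on {0..t}) (\<lambda>s. x s $ i * s ^ k) * poly r t)"
proof -
  obtain R where R: "pderiv R = r" using poly_antiderivative by blast
  have xk: "bounded_unit (\<lambda>s. x s $ i * s ^ k)" if "x \<in> Ln" for x
    using bounded_unit_mult[OF bounded_unit_component[OF that] bounded_unit_poly[of "monom 1 k"]]
    by (simp add: poly_monom)
  let ?p = "monom 1 k * ([:poly R 1:] - R)"
  obtain a g where ag: "\<And>x. x \<in> Ln \<Longrightarrow>
      integral\<^sup>L unit_leb (\<lambda>t. x t $ i * poly ?p t) = a + Ln_inner x (eval_vec g)"
    using poly_affine_component[of i ?p] unfolding poly_affine_def by blast
  have "integral\<^sup>L unit_leb (\<lambda>t. integral\<^sup>L (lebesgue_on {0..t}) (\<lambda>s. x s $ i * s ^ k) * poly r t)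
     = a + Ln_inner x (eval_vec g)" if "x \<in> Ln" for x
    using volterra_integral(2)[OF xk[OF that], of R] ag[OF that] by (simp add: R poly_monom mult.assoc)
  moreover have "bounded_unit (\<lambda>t. integral\<^sup>L (lebesgue_on {0..t}) (\<lambda>s. x s $ i * s ^ k) * poly r t)"
    if "x \<in> Ln" for x
    using volterra_integral(1)[OF xk[OF that]] by auto
  ultimately show ?thesis
    unfolding poly_affine_def by blast
qed

lemma poly_poly_eq_sum:
  "poly (poly q [:s:]) t = (\<Sum>k\<le>degree q. poly (coeff q k) t * s ^ k)" for s t :: real
  by (simp add: poly_altdef[of q] poly_sum poly_power)

lemma integral_component:
  fixes f :: "'a \<Rightarrow> 'b::euclidean_space^'k"
  assumes "integrable M f"
  shows "integral\<^sup>L M f $ i = integral\<^sup>L M (\<lambda>t. f t $ i)" "integrable M (\<lambda>t. f t $ i)"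
  using integral_bounded_linear[OF bounded_linear_vec_nth assms, of i]
    integrable_bounded_linear[OF bounded_linear_vec_nth assms, of i] by auto

lemma integrable_memory_term:
  assumes x: "x \<in> Ln" and t: "t \<in> {0..1}"
  shows "integrable (lebesgue_on {0..t}) (\<lambda>s. x s $ i *\<^sub>R eval_mat2 P t s)"
proof -
  have cont: "continuous_on {0..t} (\<lambda>s. eval_mat2 P t s)"
    unfolding eval_mat2_def poly_poly_eq_sum
    by (intro continuous_on_vec_lambda continuous_intros)
  then have "bounded (eval_mat2 P t ` {0..t})"
    by (intro compact_imp_bounded compact_continuous_image) auto
  then obtain B where B: "\<And>s. s \<in> {0..t} \<Longrightarrow> norm (eval_mat2 P t s) \<le> B"
    unfolding bounded_iff by blast
  obtain C where C: "\<And>s. s \<in> {0..1} \<Longrightarrow> \<bar>x s $ i\<bar> \<le> C"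
    using bounded_unit_component[OF x, of i] unfolding bounded_unit_def by blast
  have "(\<lambda>s. x s $ i) \<in> borel_measurable (lebesgue_on {0..t})"
    unfolding lebesgue_on_initial[OF t]
    by (rule measurable_restrict_space1[OF bounded_unit_measurable[OF bounded_unit_component[OF x]]])
  moreover have "(\<lambda>s. eval_mat2 P t s) \<in> borel_measurable (lebesgue_on {0..t})"
    by (rule continuous_imp_measurable_on_sets_lebesgue[OF cont]) simp
  ultimately have meas: "(\<lambda>s. x s $ i *\<^sub>R eval_mat2 P t s) \<in> borel_measurable (lebesgue_on {0..t})"
    by (rule borel_measurable_scaleR)
  show ?thesis
  proof (rule finite_measure.integrable_const_bound[OF _ _ meas, where B = "C * B"])
    show "finite_measure (lebesgue_on {0..t})" by (simp add: finite_measure_lebesgue_on)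
    have "\<bar>x s $ i\<bar> * norm (eval_mat2 P t s) \<le> C * B" if "s \<in> {0..t}" for s
    proof (intro mult_mono B that)
      have "s \<in> {0..1}" using that t by auto
      then show "\<bar>x s $ i\<bar> \<le> C" "0 \<le> C" using C[of s] by auto
    qed auto
    then show "AE s in lebesgue_on {0..t}. norm (x s $ i *\<^sub>R eval_mat2 P t s) \<le> C * B"
      by (intro AE_I2) simp
  qed
qed

text \<open>
  Expanding the kernel in powers of \<open>s\<close> separates the variables, which reduces the memory term to integrals
  of \<open>x s $ i * s ^ k\<close> with coefficients polynomial in \<open>t\<close>.
\<close>

lemma memory_term_entry:
  assumes x: "x \<in> Ln" and t: "t \<in> {0..1}"
  shows "integral\<^sup>L (lebesgue_on {0..t}) (\<lambda>s. x s $ i *\<^sub>R eval_mat2 P t s) $ a $ b =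
    (\<Sum>k\<le>degree (P $ a $ b). poly (coeff (P $ a $ b) k) t * integral\<^sup>L (lebesgue_on {0..t}) (\<lambda>s. x s $ i * s ^ k))"
proof -
  note int = integrable_memory_term[OF x t, of i P]
  have xk_int: "integrable (lebesgue_on {0..t}) (\<lambda>s. x s $ i * s ^ k)" for k
  proof -
    have "bounded_unit (\<lambda>s. x s $ i * s ^ k)"
      using bounded_unit_mult[OF bounded_unit_component[OF x] bounded_unit_poly[of "monom 1 k"]]
      by (simp add: poly_monom)
    then have "integrable unit_leb (\<lambda>s. x s $ i * s ^ k)" by (rule bounded_unit_integrable)
    then have "integrable unit_leb (\<lambda>s. indicator {0..t} s *\<^sub>R (x s $ i * s ^ k))"
      by (rule integrable_mult_indicator[rotated]) (use t in \<open>auto simp: sets_restrict_space\<close>)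
    then show ?thesis
      unfolding lebesgue_on_initial[OF t]
      by (subst integrable_restrict_space) (use t in \<open>auto simp: sets_restrict_space\<close>)
  qed
  have "integral\<^sup>L (lebesgue_on {0..t}) (\<lambda>s. x s $ i *\<^sub>R eval_mat2 P t s) $ a $ b =
      integral\<^sup>L (lebesgue_on {0..t}) (\<lambda>s. (x s $ i *\<^sub>R eval_mat2 P t s) $ a $ b)"
    using integral_component[OF int, of a] integral_component(1)[OF integral_component(2)[OF int, of a], of b]
    by simp
  also have "\<dots> = integral\<^sup>L (lebesgue_on {0..t})
      (\<lambda>s. \<Sum>k\<le>degree (P $ a $ b). poly (coeff (P $ a $ b) k) t * (x s $ i * s ^ k))"
    by (simp add: eval_mat2_def poly_poly_eq_sum sum_distrib_left mult_ac)
  also have "\<dots> = (\<Sum>k\<le>degree (P $ a $ b). poly (coeff (P $ a $ b) k) t * integral\<^sup>L (lebesgue_on {0..t}) (\<lambda>s. x s $ i * s ^ k))"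
    using xk_int by simp
  finally show ?thesis .
qed

lemma poly_affine_F_hat:
  fixes A :: "'n::finite \<Rightarrow> real poly^'m^'m"
  shows "poly_affine (\<lambda>x t. F_hat A0 A D x t $ a $ b * poly p t)"
proof (rule poly_affine_cong)
  show "poly_affine (\<lambda>x t. poly (A0 $ a $ b * p) t
      + (\<Sum>i\<in>UNIV. x t $ i * poly (A i $ a $ b * p) t)
      + (\<Sum>i\<in>UNIV. \<Sum>k\<le>degree (D i $ a $ b).
           integral\<^sup>L (lebesgue_on {0..t}) (\<lambda>s. x s $ i * s ^ k) * poly (coeff (D i $ a $ b) k * p) t))"
    by (intro poly_affine_add poly_affine_sum poly_affine_component poly_affine_poly
        poly_affine_volterra_monomial)
  fix x :: "real \<Rightarrow> real^'n" and t :: real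
  assume "x \<in> Ln" "t \<in> {0..1}"
  then show "F_hat A0 A D x t $ a $ b * poly p t = poly (A0 $ a $ b * p) t
      + (\<Sum>i\<in>UNIV. x t $ i * poly (A i $ a $ b * p) t)
      + (\<Sum>i\<in>UNIV. \<Sum>k\<le>degree (D i $ a $ b).
           integral\<^sup>L (lebesgue_on {0..t}) (\<lambda>s. x s $ i * s ^ k) * poly (coeff (D i $ a $ b) k * p) t)"
    by (simp add: F_hat_def memory_term_entry eval_mat_def distrib_left sum_distrib_left mult_ac)
qed

lemma poly_affine_bound:
  "poly_affine (\<lambda>x t. (\<gamma> *\<^sub>R mat 1 - diag_mat (x t)) $ a $ b * poly p t)"
  "poly_affine (\<lambda>x t. (diag_mat (x t) + \<gamma> *\<^sub>R mat 1) $ a $ b * poly p t)"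
proof -
  have "poly_affine (\<lambda>x t. poly (if a = b then smult \<gamma> p else 0) t + x t $ a * poly (if a = b then - p else 0) t)"
    by (intro poly_affine_add poly_affine_poly poly_affine_component)
  then show "poly_affine (\<lambda>x t. (\<gamma> *\<^sub>R mat 1 - diag_mat (x t)) $ a $ b * poly p t)"
    by (rule poly_affine_cong) (simp add: mat_def diag_mat_def algebra_simps)
  have "poly_affine (\<lambda>x t. poly (if a = b then smult \<gamma> p else 0) t + x t $ a * poly (if a = b then p else 0) t)"
    by (intro poly_affine_add poly_affine_poly poly_affine_component)
  then show "poly_affine (\<lambda>x t. (diag_mat (x t) + \<gamma> *\<^sub>R mat 1) $ a $ b * poly p t)"
    by (rule poly_affine_cong) (simp add: mat_def diag_mat_def algebra_simps)
qed

lemma poly_affine_F_full: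
  "poly_affine (\<lambda>x t. F_full \<gamma> A0 A D x t $ a $ b * poly p t)"
proof -
  have "poly_affine (\<lambda>x t. block_diag (M x t) (N x t) $ c $ d * poly p t)"
    if "\<And>i j. poly_affine (\<lambda>x t. M x t $ i $ j * poly p t)"
       "\<And>i j. poly_affine (\<lambda>x t. N x t $ i $ j * poly p t)"
    for M :: "(real \<Rightarrow> real^'n) \<Rightarrow> real \<Rightarrow> real^'k^'k" and N :: "(real \<Rightarrow> real^'n) \<Rightarrow> real \<Rightarrow> real^'l^'l"
      and c d
    using that by (cases c; cases d) (simp_all add: block_diag_def poly_affine_zero)
  note block = this
  show ?thesis
    unfolding F_full_def
    by (intro block poly_affine_F_hat poly_affine_bound)
qed

text \<open>
  Hence every constraint of the relaxation is an affine inequality in polynomial moments of \<open>x\<close>.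
\<close>

lemma poly_affine_trace:
  "poly_affine (\<lambda>x t. trace (F_full \<gamma> A0 A D x t ** eval_mat P t))"
  unfolding trace_def matrix_matrix_mult_def eval_mat_def
  by (simp, intro poly_affine_sum poly_affine_F_full)

section \<open>Positive semidefiniteness from polynomial multipliers\<close>

text \<open>
  Bernstein approximations of a nonnegative function are nonnegative polynomials, hence admissible weights.
\<close>

lemma continuous_weight_integral_nonneg:
  assumes h: "bounded_unit h"
    and mom: "\<And>p. (\<And>t. t \<in> {0..1} \<Longrightarrow> 0 \<le> poly p t) \<Longrightarrow> 0 \<le> integral\<^sup>L unit_leb (\<lambda>t. h t * poly p t)"
    and f: "continuous_on {0..1} f" "\<And>t. t \<in> {0..1} \<Longrightarrow> 0 \<le> f t"
  shows "0 \<le> integral\<^sup>L unit_leb (\<lambda>t. h t * f t)"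
proof (rule field_le_epsilon)
  fix \<epsilon> :: real assume \<epsilon>: "0 < \<epsilon>"
  obtain C where "\<And>t. t \<in> {0..1} \<Longrightarrow> \<bar>h t\<bar> \<le> C"
    using h unfolding bounded_unit_def by blast
  then have C: "\<And>t. t \<in> {0..1} \<Longrightarrow> \<bar>h t\<bar> \<le> \<bar>C\<bar> + 1" by force
  define \<delta> where "\<delta> = \<epsilon> / (\<bar>C\<bar> + 1)"
  have \<delta>: "0 < \<delta>" "(\<bar>C\<bar> + 1) * \<delta> = \<epsilon>"
    using \<epsilon> by (auto simp: \<delta>_def add_nonneg_pos add_nonneg_eq_0_iff)
  obtain n where n: "\<And>t. t \<in> {0..1} \<Longrightarrow>
      \<bar>f t - (\<Sum>k\<le>n. f (real k / real n) * Bernstein n k t)\<bar> < \<delta>"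
    using Bernstein_Weierstrass[OF f(1) \<delta>(1)] by blast
  define p where "p = (\<Sum>k\<le>n. smult (f (real k / real n)) (bernstein_poly n k))"
  have p: "poly p t = (\<Sum>k\<le>n. f (real k / real n) * Bernstein n k t)" for t
    by (simp add: p_def poly_sum)
  have p_nonneg: "0 \<le> poly p t" if "t \<in> {0..1}" for t
    unfolding p
  proof (rule sum_nonneg)
    fix k assume "k \<in> {..n}"
    then have "real k / real n \<in> {0..1}" by (auto simp: divide_simps)
    then show "0 \<le> f (real k / real n) * Bernstein n k t"
      using f(2) that by (intro mult_nonneg_nonneg Bernstein_nonneg) auto
  qed
  have "f \<in> borel_measurable unit_leb"
    by (intro continuous_imp_measurable_on_sets_lebesgue f) auto
  moreover have "bounded (f ` {0..1})"
    by (intro compact_imp_bounded compact_continuous_image f) auto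
  ultimately have f_bdd: "bounded_unit f"
    by (auto simp: bounded_unit_def bounded_iff)
  have hf: "integrable unit_leb (\<lambda>t. h t * f t)" and hp: "integrable unit_leb (\<lambda>t. h t * poly p t)"
    using h f_bdd by (auto intro!: bounded_unit_integrable)
  have "integral\<^sup>L unit_leb (\<lambda>t. h t * poly p t) \<le> integral\<^sup>L unit_leb (\<lambda>t. h t * f t + \<epsilon>)"
  proof (rule integral_mono[OF hp])
    show "integrable unit_leb (\<lambda>t. h t * f t + \<epsilon>)"
      using hf bounded_unit_integrable[OF bounded_unit_const, of \<epsilon>] by (rule Bochner_Integration.integrable_add)
    fix t assume "t \<in> space unit_leb"
    then have t: "t \<in> {0..1}" by simp
    have "\<bar>h t * (poly p t - f t)\<bar> \<le> (\<bar>C\<bar> + 1) * \<delta>"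
      unfolding abs_mult using C[OF t] n[OF t] by (intro mult_mono) (auto simp: p abs_minus_commute)
    then show "h t * poly p t \<le> h t * f t + \<epsilon>"
      unfolding \<delta>(2) by (simp add: right_diff_distrib)
  qed
  also have "\<dots> = integral\<^sup>L unit_leb (\<lambda>t. h t * f t) + \<epsilon>"
    using hf bounded_unit_integrable[OF bounded_unit_const, of \<epsilon>] by simp
  finally show "0 \<le> integral\<^sup>L unit_leb (\<lambda>t. h t * f t) + \<epsilon>"
    using mom[OF p_nonneg] by simp
qed

text \<open>
  Ideally one would test with the indicator \<open>u\<close> of the set where \<open>h\<close> is negative. It is an almost everywhere
  limit of continuous functions, which after clipping to \<open>[0,1]\<close> are admissible weights. Dominated convergence
  then shows that the nonpositive function \<open>h * u\<close> has nonnegative integral.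
\<close>

lemma AE_nonneg_of_polynomial_weights:
  assumes h: "bounded_unit h"
    and mom: "\<And>p. (\<And>t. t \<in> {0..1} \<Longrightarrow> 0 \<le> poly p t) \<Longrightarrow> 0 \<le> integral\<^sup>L unit_leb (\<lambda>t. h t * poly p t)"
  shows "AE t in unit_leb. 0 \<le> h t"
proof -
  have h_meas[measurable]: "h \<in> borel_measurable unit_leb"
    using h by (rule bounded_unit_measurable)
  obtain C where C: "\<And>t. t \<in> {0..1} \<Longrightarrow> \<bar>h t\<bar> \<le> C"
    using h unfolding bounded_unit_def by blast
  define u where "u t = (if h t < 0 then 1 else 0 :: real)" for t
  have u_meas[measurable]: "u \<in> borel_measurable unit_leb"
    unfolding u_def[abs_def] by measurable
  then have "u measurable_on {0..1}"
    by (simp add: measurable_on_iff_borel_measurable)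
  then obtain N g where N: "negligible N" and g: "\<And>k. continuous_on UNIV (g k)"
    and lim: "\<And>t. t \<notin> N \<Longrightarrow> (\<lambda>k. g k t) \<longlonglongrightarrow> (if t \<in> {0..1} then u t else 0)"
    unfolding measurable_on_def by blast
  define f where "f k t = max 0 (min 1 (g k t))" for k t
  have f_cont: "continuous_on {0..1} (f k)" for k
    unfolding f_def by (intro continuous_intros continuous_on_subset[OF g]) auto
  have f_meas[measurable]: "f k \<in> borel_measurable unit_leb" for k
    by (intro continuous_imp_measurable_on_sets_lebesgue f_cont) auto
  have "AE t in lebesgue. t \<notin> N"
    using N by (simp add: AE_not_in negligible_iff_null_sets)
  then have notN: "AE t in unit_leb. t \<notin> N"
    by (auto simp: AE_restrict_space_iff elim: eventually_mono)
  have "(\<lambda>k. integral\<^sup>L unit_leb (\<lambda>t. h t * f k t)) \<longlonglongrightarrow> integral\<^sup>L unit_leb (\<lambda>t. h t * u t)"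
  proof (rule integral_bounded_tendsto[OF finite_measure_unit_leb, where B = C])
    show "AE t in unit_leb. (\<lambda>k. h t * f k t) \<longlonglongrightarrow> h t * u t"
      using notN AE_space
    proof eventually_elim
      case (elim t)
      then have "(\<lambda>k. g k t) \<longlonglongrightarrow> u t" using lim[of t] by simp
      then have "(\<lambda>k. f k t) \<longlonglongrightarrow> max 0 (min 1 (u t))"
        unfolding f_def by (intro tendsto_intros)
      moreover have "max 0 (min 1 (u t)) = u t" by (simp add: u_def)
      ultimately show ?case by (auto intro: tendsto_intros)
    qed
    show "AE t in unit_leb. \<bar>h t * f k t\<bar> \<le> C" for k
    proof (rule AE_I2)
      fix t assume "t \<in> space unit_leb"
      then have "\<bar>h t\<bar> * \<bar>f k t\<bar> \<le> C * 1"
        using C[of t] by (intro mult_mono) (auto simp: f_def)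
      then show "\<bar>h t * f k t\<bar> \<le> C" by (simp add: abs_mult)
    qed
  qed measurable
  moreover have "0 \<le> integral\<^sup>L unit_leb (\<lambda>t. h t * f k t)" for k
    by (rule continuous_weight_integral_nonneg[OF h mom f_cont]) (auto simp: f_def)
  ultimately have ge: "0 \<le> integral\<^sup>L unit_leb (\<lambda>t. h t * u t)"
    by (intro LIMSEQ_le_const) auto
  have "bounded_unit (\<lambda>t. h t * u t)"
    using h u_meas by (intro bounded_unit_mult) (auto simp: bounded_unit_def u_def intro!: exI[of _ 1])
  then have int: "integrable unit_leb (\<lambda>t. - (h t * u t))"
    by (simp add: bounded_unit_integrable)
  have nonneg: "AE t in unit_leb. 0 \<le> - (h t * u t)"
    by (intro AE_I2) (simp add: u_def)
  have "integral\<^sup>L unit_leb (\<lambda>t. - (h t * u t)) = 0"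
    using ge integral_nonneg_AE[OF nonneg] by simp
  then have "AE t in unit_leb. - (h t * u t) = 0"
    using integral_nonneg_eq_0_iff_AE[OF int nonneg] by simp
  then show ?thesis
    by eventually_elim (auto simp: u_def split: if_splits)
qed

text \<open>
  The exceptional null set depends on \<open>v\<close>, but countably many \<open>v\<close> suffice: the vectors on which a form is
  negative are an open set, which meets every dense set unless it is empty.
\<close>

lemma AE_pos_semidef_of_quadratic_forms:
  fixes G :: "'a \<Rightarrow> real^'k^'k"
  assumes sym: "AE t in M. transpose (G t) = G t"
    and quad: "\<And>v. AE t in M. 0 \<le> v \<bullet> (G t *v v)"
  shows "AE t in M. pos_semidef (G t)"
proof -
  obtain S :: "(real^'k) set" where S: "countable S" "\<And>X. open X \<Longrightarrow> X \<noteq> {} \<Longrightarrow> \<exists>v\<in>S. v \<in> X"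
    by (rule countable_dense_setE) blast
  have "AE t in M. \<forall>v\<in>S. 0 \<le> v \<bullet> (G t *v v)"
    using S(1) quad by (simp add: AE_ball_countable)
  then show ?thesis
    using sym
  proof eventually_elim
    case (elim t)
    have "open {v. v \<bullet> (G t *v v) < 0}"
      by (intro open_Collect_less continuous_intros matrix_vector_mult_linear_continuous_on) 
    then have "{v. v \<bullet> (G t *v v) < 0} = {}"
      using S(2)[of "{v. v \<bullet> (G t *v v) < 0}"] elim(1) by force
    then show ?case
      using elim(2) by (auto simp: pos_semidef_def not_less)
  qed
qed

definition rank_one_poly :: "real poly \<Rightarrow> real^'k \<Rightarrow> real poly^'k^'k" where
  "rank_one_poly p v = (\<chi> i j. smult (v $ i * v $ j) p)"

lemma eval_rank_one_poly: "eval_mat (rank_one_poly p v) t = poly p t *\<^sub>R outer v"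
  by (simp add: eval_mat_def rank_one_poly_def outer_def vec_eq_iff mult_ac)

lemma trace_rank_one_poly:
  fixes M :: "real^'k^'k"
  shows "trace (M ** eval_mat (rank_one_poly p v) t) = (v \<bullet> (M *v v)) * poly p t"
  unfolding eval_rank_one_poly trace_mult_outer[symmetric]
  by (simp add: trace_mult_eq_sum sum_distrib_left mult_ac)

lemma rank_one_poly_in_S_plus:
  assumes "degree p \<le> d" "\<And>t. t \<in> {0..1} \<Longrightarrow> 0 \<le> poly p t"
  shows "rank_one_poly p v \<in> S_plus d"
proof -
  have "pos_semidef (eval_mat (rank_one_poly p v) t)" if "t \<in> {0..1}" for t
  proof -
    have "w \<bullet> (eval_mat (rank_one_poly p v) t *v w) = poly p t * (v \<bullet> w)\<^sup>2" for w
      unfolding eval_rank_one_poly quadratic_form_eq_sum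
      by (simp add: outer_def inner_vec_def power2_eq_square sum_product sum_distrib_left mult_ac)
    then show ?thesis
      using assms(2)[OF that] by (simp add: pos_semidef_def symmetric_iff eval_rank_one_poly outer_def mult_ac)
  qed
  moreover have "degree (rank_one_poly p v $ i $ j) \<le> d" for i j
    using assms(1) degree_smult_le[of "v $ i * v $ j" p] by (simp add: rank_one_poly_def)
  ultimately show ?thesis
    by (simp add: S_plus_def transpose_def rank_one_poly_def vec_eq_iff mult_ac)
qed

text \<open>
  Strong duality for the cone of matrix functions: the rank-one multipliers \<open>p * v v\<^sup>T\<close> alone already detect
  where a symmetric matrix function fails to be positive semidefinite.
\<close>

lemma AE_pos_semidef_of_S_plus:
  fixes G :: "real \<Rightarrow> real^'k^'k"
  assumes bdd: "\<And>i j. bounded_unit (\<lambda>t. G t $ i $ j)"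
    and sym: "\<And>t. t \<in> {0..1} \<Longrightarrow> transpose (G t) = G t"
    and dual: "\<And>d P. P \<in> S_plus d \<Longrightarrow> 0 \<le> integral\<^sup>L unit_leb (\<lambda>t. trace (G t ** eval_mat P t))"
  shows "AE t in unit_leb. pos_semidef (G t)"
proof (rule AE_pos_semidef_of_quadratic_forms)
  show "AE t in unit_leb. transpose (G t) = G t"
    using sym by (intro AE_I2) simp
  fix v
  show "AE t in unit_leb. 0 \<le> v \<bullet> (G t *v v)"
  proof (rule AE_nonneg_of_polynomial_weights)
    have "bounded_unit (\<lambda>t. \<Sum>i\<in>UNIV. \<Sum>j\<in>UNIV. v $ i * G t $ i $ j * v $ j)"
      using bdd by (intro bounded_unit_sum bounded_unit_mult bounded_unit_const)
    then show "bounded_unit (\<lambda>t. v \<bullet> (G t *v v))"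
      by (simp only: quadratic_form_eq_sum)
    show "0 \<le> integral\<^sup>L unit_leb (\<lambda>t. v \<bullet> (G t *v v) * poly p t)"
      if "\<And>t. t \<in> {0..1} \<Longrightarrow> 0 \<le> poly p t" for p
      using dual[OF rank_one_poly_in_S_plus[OF order_refl that]] by (simp add: trace_rank_one_poly)
  qed
qed

section \<open>Convergence of the relaxations\<close>

lemma transpose_block_diag:
  assumes "transpose M = M" "transpose N = N"
  shows "transpose (block_diag M N) = block_diag M N"
  using assms by (auto simp: symmetric_iff block_diag_def split: sum.splits)

lemma transpose_F_full:
  fixes A :: "'n::finite \<Rightarrow> real poly^'m^'m"
  assumes sym: "transpose A0 = A0" "\<And>i. transpose (A i) = A i" "\<And>i. transpose (D i) = D i"
    and x: "x \<in> Ln" "t \<in> {0..1}"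
  shows "transpose (F_full \<gamma> A0 A D x t) = F_full \<gamma> A0 A D x t"
proof -
  have entry: "A0 $ a $ b = A0 $ b $ a" "A i $ a $ b = A i $ b $ a" "D i $ a $ b = D i $ b $ a" for i a b
    using sym by (auto simp: transpose_def vec_eq_iff)
  have "F_hat A0 A D x t $ a $ b = F_hat A0 A D x t $ b $ a" for a b
    by (simp add: F_hat_def memory_term_entry[OF x] eval_mat_def
        entry(1)[of a b] entry(2)[of _ a b] entry(3)[of _ a b])
  then have "transpose (F_hat A0 A D x t) = F_hat A0 A D x t"
    by (simp add: symmetric_iff)
  moreover have "transpose (\<gamma> *\<^sub>R mat 1 - diag_mat (x t)) = \<gamma> *\<^sub>R mat 1 - diag_mat (x t)"
    "transpose (diag_mat (x t) + \<gamma> *\<^sub>R mat 1) = diag_mat (x t) + \<gamma> *\<^sub>R mat 1"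
    by (auto simp: symmetric_iff diag_mat_def mat_def)
  ultimately show ?thesis
    unfolding F_full_def by (intro transpose_block_diag)
qed

lemma tvsdp_feasible_subset_relaxed_feasible:
  "tvsdp_feasible \<gamma> A0 A D \<subseteq> relaxed_feasible \<gamma> A0 A D d"
proof
  fix x assume x: "x \<in> tvsdp_feasible \<gamma> A0 A D"
  have "0 \<le> integral\<^sup>L unit_leb (\<lambda>t. trace (F_full \<gamma> A0 A D x t ** eval_mat P t))" if P: "P \<in> S_plus d" for P
  proof (rule integral_nonneg_AE)
    have "AE t in unit_leb. pos_semidef (F_full \<gamma> A0 A D x t)"
      using x by (simp add: tvsdp_feasible_def)
    then show "AE t in unit_leb. 0 \<le> trace (F_full \<gamma> A0 A D x t ** eval_mat P t)"
      using AE_space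
    proof eventually_elim
      case (elim t)
      then show ?case
        using P by (intro trace_mult_pos_semidef_nonneg) (auto simp: S_plus_def)
    qed
  qed
  then show "x \<in> relaxed_feasible \<gamma> A0 A D d"
    using x by (simp add: relaxed_feasible_def tvsdp_feasible_def)
qed

lemma relaxed_feasible_antimono:
  assumes "d \<le> e"
  shows "relaxed_feasible \<gamma> A0 A D e \<subseteq> relaxed_feasible \<gamma> A0 A D d"
proof -
  have "S_plus d \<subseteq> (S_plus e :: (real poly^'k^'k) set)"
    unfolding S_plus_def using assms by (blast intro: order_trans)
  then show ?thesis
    by (auto simp: relaxed_feasible_def)
qed

text \<open>
  Here the explicit bound in the constraint matrix enters: multipliers supported on a single diagonal entry of the
  second and third block test \<open>\<gamma> - x $ i\<close> and \<open>x $ i + \<gamma>\<close>.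
\<close>

lemma relaxed_feasible_moments_dominated:
  assumes x: "x \<in> relaxed_feasible \<gamma> A0 A D d"
  shows "moments_dominated \<gamma> d (\<lambda>t. x t $ i)"
  unfolding moments_dominated_def
proof (intro allI impI)
  fix p :: "real poly" assume p: "degree p \<le> d" "\<forall>t\<in>{0..1}. 0 \<le> poly p t"
  have Ln: "x \<in> Ln" using x by (simp add: relaxed_feasible_def)
  have diag: "0 \<le> integral\<^sup>L unit_leb (\<lambda>t. F_full \<gamma> A0 A D x t $ k $ k * poly p t)" for k
  proof -
    have "rank_one_poly p (axis k 1) \<in> S_plus d"
      using p by (intro rank_one_poly_in_S_plus) auto
    then have "0 \<le> integral\<^sup>L unit_leb (\<lambda>t. trace (F_full \<gamma> A0 A D x t ** eval_mat (rank_one_poly p (axis k 1)) t))"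
      using x unfolding relaxed_feasible_def by blast
    then show ?thesis
      by (simp add: trace_rank_one_poly quadratic_form_axis)
  qed
  have int: "integrable unit_leb (\<lambda>t. x t $ i * poly p t)" "integrable unit_leb (poly p)"
    using Ln by (auto intro!: bounded_unit_integrable)
  have "0 \<le> integral\<^sup>L unit_leb (\<lambda>t. \<gamma> * poly p t - x t $ i * poly p t)"
    using diag[of "Inr (Inl i)"] by (simp add: F_full_def block_diag_def diag_mat_def mat_def algebra_simps)
  moreover have "0 \<le> integral\<^sup>L unit_leb (\<lambda>t. \<gamma> * poly p t + x t $ i * poly p t)"
    using diag[of "Inr (Inr i)"] by (simp add: F_full_def block_diag_def diag_mat_def mat_def algebra_simps)
  ultimately show "\<bar>integral\<^sup>L unit_leb (\<lambda>t. x t $ i * poly p t)\<bar> \<le> \<gamma> * integral\<^sup>L unit_leb (poly p)"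
    using int by simp
qed

text \<open>
  The functions \<open>x d\<close> themselves need not be bounded uniformly in \<open>d\<close>, so compactness is applied to their
  surrogates \<open>y d\<close>. Since \<open>x d\<close> and \<open>y d\<close> have asymptotically equal polynomial moments, eventual lower bounds on
  a moment of \<open>x d\<close> are inherited by the limit.
\<close>

lemma polynomial_moment_limit:
  fixes x :: "nat \<Rightarrow> real \<Rightarrow> real^'n"
  assumes \<gamma>: "0 \<le> \<gamma>" and x: "\<And>d. x d \<in> Ln" "\<And>d i. moments_dominated \<gamma> d (\<lambda>t. x d t $ i)"
  obtains z where "z \<in> Ln"
    "\<And>g a N. (\<And>d. N \<le> d \<Longrightarrow> a \<le> Ln_inner (x d) (eval_vec g)) \<Longrightarrow> a \<le> Ln_inner z (eval_vec g)"
proof -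
  define y where "y d t = (\<chi> i. bernstein_step d (\<lambda>s. x d s $ i) t)" for d t
  have y_meas: "y d \<in> borel_measurable unit_leb" for d
    unfolding borel_measurable_euclidean_space[of "y d"] by (auto simp: y_def Basis_vec_def inner_axis)
  have y_le: "\<bar>y d t $ i\<bar> \<le> \<gamma>" for d t i
    unfolding y_def using abs_bernstein_step_le[OF x(2) \<gamma>] by simp
  have y_Ln: "y d \<in> Ln" for d
    unfolding Ln_def using y_meas y_le by blast
  have y_norm: "norm (y d t) \<le> real CARD('n) * \<gamma>" for d t
    using norm_le_l1_cart[of "y d t"] sum_bounded_above[of UNIV "\<lambda>i. \<bar>y d t $ i\<bar>" \<gamma>] y_le
    by force
  have K_nonneg: "0 \<le> real CARD('n) * \<gamma>"
    using \<gamma> by simp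
  obtain z where z: "z \<in> borel_measurable unit_leb" "\<And>t. norm (z t) \<le> real CARD('n) * \<gamma>"
    and z_lim: "\<forall>f C a N. f \<in> borel_measurable unit_leb \<longrightarrow> (\<forall>t\<in>space unit_leb. norm (f t) \<le> C) \<longrightarrow>
       (\<forall>e\<ge>N. a \<le> integral\<^sup>L unit_leb (\<lambda>t. y e t \<bullet> f t)) \<longrightarrow> a \<le> integral\<^sup>L unit_leb (\<lambda>t. z t \<bullet> f t)"
    using bounded_sequence_weak_limit[of unit_leb y, OF finite_measure_unit_leb y_meas y_norm K_nonneg]
    by blast
  have inner: "Ln_inner w f = integral\<^sup>L unit_leb (\<lambda>t. w t \<bullet> f t)" for w f :: "real \<Rightarrow> real^'n"
    by (simp add: Ln_inner_def inner_vec_def)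
  show thesis
  proof
    show "z \<in> Ln"
      unfolding Ln_def using z order_trans[OF component_le_norm_cart z(2)] by blast
    fix g :: "real poly^'n" and a N
    assume a: "\<And>d. N \<le> d \<Longrightarrow> a \<le> Ln_inner (x d) (eval_vec g)"
    have cont: "continuous_on {0..1} (eval_vec g)"
      unfolding eval_vec_def[abs_def] by (intro continuous_on_vec_lambda continuous_intros)
    have g_meas: "eval_vec g \<in> borel_measurable unit_leb"
      by (intro continuous_imp_measurable_on_sets_lebesgue cont) auto
    have "bounded (eval_vec g ` {0..1})"
      by (intro compact_imp_bounded compact_continuous_image cont) auto
    then obtain C where C: "\<And>t. t \<in> {0..1} \<Longrightarrow> norm (eval_vec g t) \<le> C"
      unfolding bounded_iff by blast
    show "a \<le> Ln_inner z (eval_vec g)"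
    proof (rule field_le_epsilon)
      fix \<epsilon> :: real assume \<epsilon>: "0 < \<epsilon>"
      define \<delta> where "\<delta> = \<epsilon> / real CARD('n)"
      have \<delta>: "0 < \<delta>" using \<epsilon> by (simp add: \<delta>_def)
      have "\<exists>K. \<forall>n\<ge>K. \<forall>w. bounded_unit w \<longrightarrow> moments_dominated \<gamma> n w \<longrightarrow>
        \<bar>integral\<^sup>L unit_leb (\<lambda>t. bernstein_step n w t * poly (g $ i) t) - integral\<^sup>L unit_leb (\<lambda>t. w t * poly (g $ i) t)\<bar> \<le> \<delta>" for i
        by (rule bernstein_step_moments[OF \<gamma> \<delta>, of "g $ i"]) blast
      then obtain K where K: "\<And>i n w. K i \<le> n \<Longrightarrow> bounded_unit w \<Longrightarrow> moments_dominated \<gamma> n w \<Longrightarrow>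
        \<bar>integral\<^sup>L unit_leb (\<lambda>t. bernstein_step n w t * poly (g $ i) t) - integral\<^sup>L unit_leb (\<lambda>t. w t * poly (g $ i) t)\<bar> \<le> \<delta>"
        by metis
      define L where "L = max N (Max (range K))"
      have "a - \<epsilon> \<le> Ln_inner (y d) (eval_vec g)" if "L \<le> d" for d
      proof -
        have "K i \<le> d" for i
          using that Max_ge[of "range K" "K i"] unfolding L_def by simp
        then have close: "\<bar>integral\<^sup>L unit_leb (\<lambda>t. y d t $ i * poly (g $ i) t) - integral\<^sup>L unit_leb (\<lambda>t. x d t $ i * poly (g $ i) t)\<bar> \<le> \<delta>" for i
          using K[of i d "\<lambda>t. x d t $ i"] x by (auto simp: y_def)
        have "Ln_inner (x d) (eval_vec g) - Ln_inner (y d) (eval_vec g) \<le> (\<Sum>i::'n\<in>UNIV. \<delta>)"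
          unfolding Ln_inner_eval_vec[OF x(1)] Ln_inner_eval_vec[OF y_Ln] sum_subtractf[symmetric]
        proof (rule sum_mono)
          show "integral\<^sup>L unit_leb (\<lambda>t. x d t $ i * poly (g $ i) t) - integral\<^sup>L unit_leb (\<lambda>t. y d t $ i * poly (g $ i) t) \<le> \<delta>" for i
            using close[of i] by (simp add: abs_le_iff)
        qed
        also have "\<dots> = \<epsilon>" by (simp add: \<delta>_def)
        finally show ?thesis
          using a[of d] that by (simp add: L_def)
      qed
      then have "a - \<epsilon> \<le> Ln_inner z (eval_vec g)"
        unfolding inner using C g_meas by (intro z_lim[rule_format, of "eval_vec g" C L]) auto
      then show "a \<le> Ln_inner z (eval_vec g) + \<epsilon>" by simp
    qed
  qed
qed

text \<open>
  A fixed multiplier of degree \<open>N\<close> is available in all relaxations of order \<open>d \<ge> N\<close>. The inequality that it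
  imposes, like the one for the objective, is a lower bound on a polynomial moment, so it survives in the limit.
\<close>

lemma feasible_limit:
  fixes A :: "'n::finite \<Rightarrow> real poly^'m^'m"
  assumes \<gamma>: "0 \<le> \<gamma>"
    and sym: "transpose A0 = A0" "\<And>i. transpose (A i) = A i" "\<And>i. transpose (D i) = D i"
    and x: "\<And>d. x d \<in> relaxed_feasible \<gamma> A0 A D d"
    and r: "\<And>d. r \<le> Ln_inner (x d) (eval_vec c)"
  obtains z where "z \<in> tvsdp_feasible \<gamma> A0 A D" "r \<le> Ln_inner z (eval_vec c)"
proof -
  have Ln: "x d \<in> Ln" for d using x by (simp add: relaxed_feasible_def)
  obtain z where z: "z \<in> Ln" and z_lim:
    "\<And>g a N. (\<And>d. N \<le> d \<Longrightarrow> a \<le> Ln_inner (x d) (eval_vec g)) \<Longrightarrow> a \<le> Ln_inner z (eval_vec g)"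
    using polynomial_moment_limit[OF \<gamma> Ln relaxed_feasible_moments_dominated[OF x]] by metis
  have "0 \<le> integral\<^sup>L unit_leb (\<lambda>t. trace (F_full \<gamma> A0 A D z t ** eval_mat P t))" if P: "P \<in> S_plus N" for N P
  proof -
    obtain a g where ag: "\<And>w. w \<in> Ln \<Longrightarrow>
        integral\<^sup>L unit_leb (\<lambda>t. trace (F_full \<gamma> A0 A D w t ** eval_mat P t)) = a + Ln_inner w (eval_vec g)"
      using poly_affine_trace[of \<gamma> A0 A D P] unfolding poly_affine_def by blast
    have "- a \<le> Ln_inner (x d) (eval_vec g)" if "N \<le> d" for d
    proof -
      have "x d \<in> relaxed_feasible \<gamma> A0 A D N"
        using x relaxed_feasible_antimono[OF that] by blast
      then have "0 \<le> a + Ln_inner (x d) (eval_vec g)"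
        using P ag[OF Ln, of d] by (auto simp: relaxed_feasible_def)
      then show ?thesis by simp
    qed
    then have "- a \<le> Ln_inner z (eval_vec g)" by (rule z_lim)
    then show ?thesis using ag[OF z] by simp
  qed
  moreover have "bounded_unit (\<lambda>t. F_full \<gamma> A0 A D z t $ i $ j)" for i j
    using poly_affine_F_full[of \<gamma> A0 A D i j 1] z by (auto simp: poly_affine_def)
  ultimately have "AE t in unit_leb. pos_semidef (F_full \<gamma> A0 A D z t)"
    by (intro AE_pos_semidef_of_S_plus transpose_F_full sym z) auto
  then have "z \<in> tvsdp_feasible \<gamma> A0 A D"
    using z by (simp add: tvsdp_feasible_def)
  moreover have "r \<le> Ln_inner z (eval_vec c)"
    using r by (intro z_lim)
  ultimately show thesis by (rule that)
qed

theorem theorem7: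
  fixes \<gamma> :: real
    and c :: "real poly^'n"
    and A0 :: "real poly^'m^'m"
    and A :: "'n \<Rightarrow> real poly^'m^'m"
    and D :: "'n \<Rightarrow> real poly poly^'m^'m"
  assumes "\<gamma> > 0"
    and "transpose A0 = A0"
    and "\<And>i. transpose (A i) = A i"
    and "\<And>i. transpose (D i) = D i"
  shows "(\<lambda>d. relaxed_opt \<gamma> c A0 A D d) \<longlonglongrightarrow> tvsdp_opt \<gamma> c A0 A D"
proof -
  let ?u = "\<lambda>d. relaxed_opt \<gamma> c A0 A D d"
  have commute: "Ln_inner (eval_vec c) x = Ln_inner x (eval_vec c)" for x
    by (simp add: Ln_inner_def mult.commute)
  have "decseq ?u"
    unfolding relaxed_opt_def decseq_def
    by (intro allI impI SUP_subset_mono relaxed_feasible_antimono) auto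
  then have lim: "?u \<longlonglongrightarrow> (INF d. ?u d)"
    by (rule LIMSEQ_INF)
  have "tvsdp_opt \<gamma> c A0 A D \<le> (INF d. ?u d)"
    unfolding relaxed_opt_def tvsdp_opt_def
    by (intro INF_greatest SUP_subset_mono tvsdp_feasible_subset_relaxed_feasible) auto
  moreover have "(INF d. ?u d) \<le> tvsdp_opt \<gamma> c A0 A D"
  proof (rule ccontr)
    assume "\<not> ?thesis"
    \<comment> \<open>A real number strictly between the two values keeps the objective values away from the infinities.\<close>
    then obtain r where r: "tvsdp_opt \<gamma> c A0 A D < ereal r" "ereal r < (INF d. ?u d)"
      using ereal_dense2[of "tvsdp_opt \<gamma> c A0 A D"] by (auto simp: not_le)
    have "\<exists>x\<in>relaxed_feasible \<gamma> A0 A D d. r \<le> Ln_inner x (eval_vec c)" for d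
    proof -
      have "ereal r < ?u d"
        using r(2) INF_lower[of d UNIV ?u] by (auto intro: less_le_trans)
      then show ?thesis
        unfolding relaxed_opt_def by (auto simp: less_SUP_iff commute intro: less_imp_le)
    qed
    then obtain x where "\<And>d. x d \<in> relaxed_feasible \<gamma> A0 A D d" "\<And>d. r \<le> Ln_inner (x d) (eval_vec c)"
      by metis
    then obtain z where "z \<in> tvsdp_feasible \<gamma> A0 A D" "r \<le> Ln_inner z (eval_vec c)"
      using feasible_limit[of \<gamma> A0 A D x r c] assms by auto
    then have "ereal r \<le> tvsdp_opt \<gamma> c A0 A D"
      unfolding tvsdp_opt_def by (intro SUP_upper2[of z]) (auto simp: commute)
    then show False using r(1) by simp
  qed
  ultimately show ?thesis using lim by (metis order.antisym)
qed

end
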